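(* For every $\alpha\in\mathbb{R}$, the $\alpha$-divergence $\mathcal{D}_\alpha$ is of class $C^\infty$ on $M\times M$, i.e. $\mathcal{D}_\alpha\in C^\infty(M\times M;\mathbb{R})$.
   Context: Let $B$ be an open subset of a (real) Banach space $\mathbb{X}$, let $\mathcal{X}_B$ be the Borel $\sigma$-algebra of $B$, and let $\mu$ be a probability measure on $(B,\mathcal{X}_B)$ such that $\mu(A)>0$ for every non-empty open $A\in\mathcal{X}_B$. Fix $k\in\mathbb{N}_0$. $\mathbb{G}:=C_b^k(B;\mathbb{R})$ is the Banach space of bounded continuous functions $a:B\to\mathbb{R}$ with bounded continuous Fréchet derivatives $a^{(i)}$ of all orders $1\le i\le k$, with norm $\|a\|_{\mathbb{G}}=\sup_{x\in B}|a(x)|+\sum_{i=1}^k\sup_{x\in B}\|a_x^{(i)}\|_{L(\mathbb{X}^i;\mathbb{R})}$. $\exp_{\mathbb{G}}(a)(x)=\exp(a(x))$ and $\mathbf{E}_\mu a=\int_B a\,d\mu$. $M$ is the set of finite measures $P$ on $(B,\mathcal{X}_B)$ that are mutually absolutely continuous with respect to $\mu$ and have densities $dP/d\mu=\exp_{\mathbb{G}}(a)$ for some $a\in\mathbb{G}$. It is a smooth Banach manifold modelled on $\mathbb{G}$ with the single global chart $\phi_1:M\to\mathbb{G}$, $\phi_1(P)=\log(dP/d\mu)$ (a bijection). For $\alpha\in\mathbb{R}\setminus\{1\}$, $\phi_\alpha:M\to\mathbb{G}$ is defined by $$\phi_\alpha(P)=\tfrac{2}{1-\alpha}\left(\exp_{\mathbb{G}}\left(\tfrac{1-\alpha}{2}\phi_1(P)\right)-1\right).$$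 The $\alpha$-divergences $\mathcal{D}_\alpha(\cdot\,|\,\cdot):M\times M\to\mathbb{R}$ are defined by $$\mathcal{D}_{-1}(P\,|\,Q)=\mathcal{D}_1(Q\,|\,P)=\mathbf{E}_\mu(\phi_{-1}(Q)-\phi_{-1}(P))+\langle\phi_{-1}(P)+1,\,\phi_1(P)-\phi_1(Q)\rangle_{L^2(\mu)},$$ and, for $\alpha\ne\pm1$, $$\mathcal{D}_\alpha(P\,|\,Q)=\tfrac{2}{1+\alpha}\mathbf{E}_\mu(\phi_{-1}(P)-\phi_\alpha(P))+\tfrac{2}{1-\alpha}\mathbf{E}_\mu(\phi_{-1}(Q)-\phi_{-\alpha}(Q))-\langle\phi_\alpha(P),\phi_{-\alpha}(Q)\rangle_{L^2(\mu)}.$$ *)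

theory Defs
  imports "HOL-Probability.Probability" "HOL-Library.Function_Algebras"
begin

text \<open>
  The space \<open>C\<^sub>b\<^sup>k(B; \<real>)\<close> depends on the set \<open>B\<close> and the number \<open>k\<close>, so it is represented as a
  subspace \<open>V\<close> of a real vector space together with a norm \<open>N\<close> on \<open>V\<close>. The calculus below is
  formulated for such pairs and is used both for functions on \<open>B\<close> (with \<open>V = UNIV\<close> and the norm
  of the type) and for functions on \<open>C\<^sub>b\<^sup>k(B; \<real>) \<times> C\<^sub>b\<^sup>k(B; \<real>)\<close>.
\<close>

instantiation "fun" :: (type, real_vector) real_vector
begin

definition scaleR_fun :: "real \<Rightarrow> ('a \<Rightarrow> 'b) \<Rightarrow> 'a \<Rightarrow> 'b"
  where "scaleR_fun c f = (\<lambda>x. c *\<^sub>R f x)"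

instance
  by standard (simp_all add: scaleR_fun_def plus_fun_def scaleR_add_left scaleR_add_right)

end

section \<open>Frechet derivatives of all orders\<close>

text \<open>
  The space \<open>L(V\<^sup>i; \<real>)\<close> of bounded \<open>i\<close>-linear forms. The arguments of a form are the entries of a
  list of length \<open>i\<close>; forms vanish on all other lists, which makes them equal as functions as
  soon as they agree on \<open>V\<^sup>i\<close>.
\<close>

definition multilinear_forms :: "'v::real_vector set \<Rightarrow> ('v \<Rightarrow> real) \<Rightarrow> nat \<Rightarrow> ('v list \<Rightarrow> real) set"
  where "multilinear_forms V N i = {m.
     (\<forall>vs. \<not> (length vs = i \<and> set vs \<subseteq> V) \<longrightarrow> m vs = 0) \<and>
     (\<forall>vs j. length vs = i \<and> set vs \<subseteq> V \<and> j < i \<longrightarrow>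
        (\<forall>v\<in>V. \<forall>w\<in>V. m (vs[j := v + w]) = m (vs[j := v]) + m (vs[j := w])) \<and>
        (\<forall>c. \<forall>v\<in>V. m (vs[j := c *\<^sub>R v]) = c * m (vs[j := v]))) \<and>
     (\<exists>C. \<forall>vs. length vs = i \<and> set vs \<subseteq> V \<longrightarrow> \<bar>m vs\<bar> \<le> C * (\<Prod>v\<leftarrow>vs. N v))}"

definition form_norm :: "'v set \<Rightarrow> ('v \<Rightarrow> real) \<Rightarrow> nat \<Rightarrow> ('v list \<Rightarrow> real) \<Rightarrow> real"
  where "form_norm V N i m =
     (SUP vs \<in> {vs. length vs = i \<and> set vs \<subseteq> V \<and> (\<forall>v\<in>set vs. N v \<le> 1)}. \<bar>m vs\<bar>)"

text \<open>
  Frechet derivative at \<open>x\<close> of a map \<open>A : U \<rightarrow> L(V\<^sup>i; \<real>)\<close>, under the identification of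
  \<open>L(V; L(V\<^sup>i; \<real>))\<close> with \<open>L(V\<^sup>i\<^sup>+\<^sup>1; \<real>)\<close> that puts the new direction first.
\<close>

definition has_form_derivative ::
    "'v::real_vector set \<Rightarrow> ('v \<Rightarrow> real) \<Rightarrow> 'v set \<Rightarrow> nat \<Rightarrow>
     ('v \<Rightarrow> 'v list \<Rightarrow> real) \<Rightarrow> ('v list \<Rightarrow> real) \<Rightarrow> 'v \<Rightarrow> bool"
  where "has_form_derivative V N U i A A' x \<longleftrightarrow>
     A' \<in> multilinear_forms V N (Suc i) \<and>
     (\<forall>\<epsilon>>0. \<exists>\<delta>>0. \<forall>h\<in>V. x + h \<in> U \<and> N h < \<delta> \<longrightarrow>
        form_norm V N i (\<lambda>vs. A (x + h) vs - A x vs - A' (h # vs)) \<le> \<epsilon> * N h)"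

definition form_continuous ::
    "'v::real_vector set \<Rightarrow> ('v \<Rightarrow> real) \<Rightarrow> 'v set \<Rightarrow> nat \<Rightarrow> ('v \<Rightarrow> 'v list \<Rightarrow> real) \<Rightarrow> bool"
  where "form_continuous V N U i A \<longleftrightarrow>
     (\<forall>x\<in>U. \<forall>\<epsilon>>0. \<exists>\<delta>>0. \<forall>y\<in>U. N (y - x) < \<delta> \<longrightarrow>
        form_norm V N i (\<lambda>vs. A y vs - A x vs) < \<epsilon>)"

text \<open>
  The \<open>i\<close>-th derivative of \<open>f : U \<rightarrow> \<real>\<close>, for \<open>U\<close> open in \<open>V\<close>. It is unspecified where the
  derivative does not exist, as for \<^const>\<open>frechet_derivative\<close>.
\<close>

primrec nth_derivative ::
    "'v::real_vector set \<Rightarrow> ('v \<Rightarrow> real) \<Rightarrow> 'v set \<Rightarrow> ('v \<Rightarrow> real) \<Rightarrow> nat \<Rightarrow> 'v \<Rightarrow> 'v list \<Rightarrow> real"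
  where
    "nth_derivative V N U f 0 = (\<lambda>x vs. if vs = [] then f x else 0)"
  | "nth_derivative V N U f (Suc i) =
       (\<lambda>x. SOME A'. has_form_derivative V N U i (nth_derivative V N U f i) A' x)"

definition C_k_on ::
    "'v::real_vector set \<Rightarrow> ('v \<Rightarrow> real) \<Rightarrow> nat \<Rightarrow> 'v set \<Rightarrow> ('v \<Rightarrow> real) \<Rightarrow> bool"
  where "C_k_on V N k U f \<longleftrightarrow>
     (\<forall>i<k. \<forall>x\<in>U. \<exists>A'. has_form_derivative V N U i (nth_derivative V N U f i) A' x) \<and>
     (\<forall>i\<le>k. form_continuous V N U i (nth_derivative V N U f i))"

definition C_infinity_on ::
    "'v::real_vector set \<Rightarrow> ('v \<Rightarrow> real) \<Rightarrow> 'v set \<Rightarrow> ('v \<Rightarrow> real) \<Rightarrow> bool"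
  where "C_infinity_on V N U f \<longleftrightarrow> (\<forall>k. C_k_on V N k U f)"

text \<open>
  Functions of class \<open>C\<^sup>\<infinity>\<close> on a manifold modelled on \<open>(V, N)\<close> whose atlas consists of
  the single chart \<open>\<phi> : M \<rightarrow> V\<close>, a bijection.
\<close>

definition C_infinity_manifold ::
    "'v::real_vector set \<Rightarrow> ('v \<Rightarrow> real) \<Rightarrow> 'm set \<Rightarrow> ('m \<Rightarrow> 'v) \<Rightarrow> ('m \<Rightarrow> real) \<Rightarrow> bool"
  where "C_infinity_manifold V N M \<phi> F \<longleftrightarrow> C_infinity_on V N V (F \<circ> inv_into M \<phi>)"

definition prod_norm :: "('v \<Rightarrow> real) \<Rightarrow> ('w \<Rightarrow> real) \<Rightarrow> 'v \<times> 'w \<Rightarrow> real"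
  where "prod_norm N N' = (\<lambda>(v, w). max (N v) (N' w))"

section \<open>The model space and the manifold\<close>

text \<open>
  Functions on \<open>B\<close> are extended by \<open>0\<close> to the whole type.
\<close>

definition Cb :: "nat \<Rightarrow> 'x::real_normed_vector set \<Rightarrow> ('x \<Rightarrow> real) set"
  where "Cb k B = {a. (\<forall>x. x \<notin> B \<longrightarrow> a x = 0) \<and> C_k_on UNIV norm k B a \<and> bounded (a ` B) \<and>
     (\<forall>i\<in>{1..k}. bounded ((\<lambda>x. form_norm UNIV norm i (nth_derivative UNIV norm B a i x)) ` B))}"

definition Cb_norm :: "nat \<Rightarrow> 'x::real_normed_vector set \<Rightarrow> ('x \<Rightarrow> real) \<Rightarrow> real"
  where "Cb_norm k B a = (SUP x\<in>B. \<bar>a x\<bar>) +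
     (\<Sum>i=1..k. SUP x\<in>B. form_norm UNIV norm i (nth_derivative UNIV norm B a i x))"

definition stat_manifold ::
    "nat \<Rightarrow> 'x::real_normed_vector set \<Rightarrow> 'x measure \<Rightarrow> 'x measure set"
  where "stat_manifold k B \<mu> = {P. finite_measure P \<and> sets P = sets \<mu> \<and>
     absolutely_continuous \<mu> P \<and> absolutely_continuous P \<mu> \<and>
     (\<exists>a\<in>Cb k B. P = density \<mu> (\<lambda>x. ennreal (exp (a x))))}"

text \<open>
  The chart \<open>log (dP/d\<mu>)\<close>: among the \<open>\<mu>\<close>-versions of the log-density, the one in \<open>C\<^sub>b\<^sup>k(B; \<real>)\<close>.
\<close>

definition phi_1 ::
    "nat \<Rightarrow> 'x::real_normed_vector set \<Rightarrow> 'x measure \<Rightarrow> 'x measure \<Rightarrow> 'x \<Rightarrow> real"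
  where "phi_1 k B \<mu> P =
     (THE a. a \<in> Cb k B \<and> P = density \<mu> (\<lambda>x. ennreal (exp (a x))))"

definition phi ::
    "nat \<Rightarrow> 'x::real_normed_vector set \<Rightarrow> 'x measure \<Rightarrow> real \<Rightarrow> 'x measure \<Rightarrow> 'x \<Rightarrow> real"
  where "phi k B \<mu> \<alpha> P = (if \<alpha> = 1 then phi_1 k B \<mu> P
     else (\<lambda>x. 2 / (1 - \<alpha>) * (exp ((1 - \<alpha>) / 2 * phi_1 k B \<mu> P x) - 1)))"

section \<open>The divergences\<close>

definition divergence_m1 ::
    "nat \<Rightarrow> 'x::real_normed_vector set \<Rightarrow> 'x measure \<Rightarrow> 'x measure \<Rightarrow> 'x measure \<Rightarrow> real"
  where "divergence_m1 k B \<mu> P Q =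
     (\<integral>x. (phi k B \<mu> (-1) Q x - phi k B \<mu> (-1) P x) \<partial>\<mu>) +
     (\<integral>x. (phi k B \<mu> (-1) P x + 1) * (phi k B \<mu> 1 P x - phi k B \<mu> 1 Q x) \<partial>\<mu>)"

definition divergence ::
    "nat \<Rightarrow> 'x::real_normed_vector set \<Rightarrow> 'x measure \<Rightarrow> real \<Rightarrow> 'x measure \<Rightarrow> 'x measure \<Rightarrow> real"
  where "divergence k B \<mu> \<alpha> P Q =
    (if \<alpha> = -1 then divergence_m1 k B \<mu> P Q
     else if \<alpha> = 1 then divergence_m1 k B \<mu> Q P
     else 2 / (1 + \<alpha>) * (\<integral>x. (phi k B \<mu> (-1) P x - phi k B \<mu> \<alpha> P x) \<partial>\<mu>)
        + 2 / (1 - \<alpha>) * (\<integral>x. (phi k B \<mu> (-1) Q x - phi k B \<mu> (-\<alpha>) Q x) \<partial>\<mu>)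
        - (\<integral>x. phi k B \<mu> \<alpha> P x * phi k B \<mu> (-\<alpha>) Q x \<partial>\<mu>))"

section \<open>The chart is a bijection\<close>

lemma Cb_continuous_on:
  assumes "a \<in> Cb k B" shows "continuous_on B a"
proof -
  have *: "form_continuous UNIV norm B 0 (nth_derivative UNIV norm B a 0)"
    using assms unfolding Cb_def C_k_on_def by blast
  have "{vs. vs = [] \<and> (\<forall>v\<in>set vs. norm v \<le> 1)} = {[]::'a list}" by auto
  then show ?thesis
    using * unfolding form_continuous_def form_norm_def
    by (simp add: continuous_on_iff dist_norm)
qed

lemma exp_Cb_measurable:
  assumes "a \<in> Cb k B" "sets \<mu> = sets (restrict_space borel B)"
  shows "(\<lambda>x. ennreal (exp (a x))) \<in> borel_measurable \<mu>"
proof -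
  have "a \<in> borel_measurable (restrict_space borel B)"
    by (rule borel_measurable_continuous_on_restrict[OF Cb_continuous_on[OF assms(1)]])
  then have [measurable]: "a \<in> borel_measurable \<mu>"
    using measurable_cong_sets[OF assms(2) refl] by blast
  show ?thesis by measurable
qed

lemma Cb_density_unique:
  fixes B :: "'x::real_normed_vector set"
  assumes B: "open B" and mu: "prob_space \<mu>" "sets \<mu> = sets (restrict_space borel B)"
    and pos: "\<And>A. open A \<Longrightarrow> A \<subseteq> B \<Longrightarrow> A \<noteq> {} \<Longrightarrow> measure \<mu> A > 0"
    and a: "a \<in> Cb k B" and b: "b \<in> Cb k B"
    and eq: "density \<mu> (\<lambda>x. ennreal (exp (a x))) = density \<mu> (\<lambda>x. ennreal (exp (b x)))"
  shows "a = b"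
proof -
  interpret prob_space \<mu> by (rule mu)
  have sp: "space \<mu> = B" using sets_eq_imp_space_eq[OF mu(2)] by (simp add: space_restrict_space)
  let ?A = "{x\<in>B. a x \<noteq> b x}"
  have "AE x in \<mu>. ennreal (exp (a x)) = ennreal (exp (b x))"
    using density_unique_iff[OF exp_Cb_measurable[OF a mu(2)] exp_Cb_measurable[OF b mu(2)]] eq
    by simp
  then have ae: "AE x in \<mu>. a x = b x" by simp
  have "?A = B \<inter> (\<lambda>x. a x - b x) -` (- {0})" by auto
  moreover have "continuous_on B (\<lambda>x. a x - b x)"
    by (intro continuous_intros Cb_continuous_on[OF a] Cb_continuous_on[OF b])
  ultimately have op: "open ?A"
    using continuous_open_preimage[of B "\<lambda>x. a x - b x" "- {0}"] B
    by (simp add: open_Compl)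
  have "?A \<in> sets \<mu>" unfolding mu(2)
    using op B by (subst sets_restrict_space_iff) auto
  then have "emeasure \<mu> ?A = 0"
    using AE_iff_measurable[of ?A \<mu> "\<lambda>x. a x = b x"] ae sp by simp
  then have "measure \<mu> ?A = 0" by (simp add: measure_def)
  moreover have "?A \<subseteq> B" by blast
  ultimately have "?A = {}" using pos[OF op] less_irrefl[of "0::real"] by argo
  moreover have "a x = 0" "b x = 0" if "x \<notin> B" for x using a b that by (simp_all add: Cb_def)
  ultimately have "a x = b x" for x by (cases "x \<in> B") auto
  then show ?thesis by (rule ext)
qed

lemma phi_1_density:
  fixes B :: "'x::real_normed_vector set"
  assumes "open B" "prob_space \<mu>" "sets \<mu> = sets (restrict_space borel B)"
    and "\<And>A. open A \<Longrightarrow> A \<subseteq> B \<Longrightarrow> A \<noteq> {} \<Longrightarrow> measure \<mu> A > 0"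
    and "a \<in> Cb k B"
  shows "phi_1 k B \<mu> (density \<mu> (\<lambda>x. ennreal (exp (a x)))) = a"
  unfolding phi_1_def
proof (rule the_equality)
  fix b assume "b \<in> Cb k B \<and>
    density \<mu> (\<lambda>x. ennreal (exp (a x))) = density \<mu> (\<lambda>x. ennreal (exp (b x)))"
  then show "b = a" using Cb_density_unique[OF assms(1-4), of b k a] assms(5) by metis
qed (use assms(5) in simp)

lemma density_in_stat_manifold:
  fixes B :: "'x::real_normed_vector set"
  assumes mu: "prob_space \<mu>" "sets \<mu> = sets (restrict_space borel B)" and a: "a \<in> Cb k B"
  shows "density \<mu> (\<lambda>x. ennreal (exp (a x))) \<in> stat_manifold k B \<mu>"
proof -
  interpret prob_space \<mu> by (rule mu)
  have sp: "space \<mu> = B" using sets_eq_imp_space_eq[OF mu(2)] by (simp add: space_restrict_space)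
  note m [measurable] = exp_Cb_measurable[OF a mu(2)]
  let ?P = "density \<mu> (\<lambda>x. ennreal (exp (a x)))"
  obtain c where c: "\<And>x. x \<in> B \<Longrightarrow> \<bar>a x\<bar> \<le> c"
  proof -
    have "bounded (a ` B)" using a by (simp add: Cb_def)
    then show thesis using that unfolding bounded_iff by auto
  qed
  have "emeasure ?P (space ?P) = (\<integral>\<^sup>+x. ennreal (exp (a x)) * indicator (space \<mu>) x \<partial>\<mu>)"
    using emeasure_density[OF m, of "space \<mu>"] by simp
  also have "\<dots> \<le> (\<integral>\<^sup>+x. ennreal (exp c) \<partial>\<mu>)"
    using c by (intro nn_integral_mono) (force simp: sp indicator_def intro!: ennreal_leI)
  also have "\<dots> < \<infinity>" by (simp add: emeasure_space_1)
  finally have "finite_measure ?P" by (intro finite_measureI) auto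
  moreover have "absolutely_continuous \<mu> ?P" by (rule absolutely_continuousI_density[OF m])
  moreover have "absolutely_continuous ?P \<mu>"
    unfolding absolutely_continuous_def
  proof
    fix N assume "N \<in> null_sets ?P"
    then have N: "N \<in> sets \<mu>" "AE x in \<mu>. x \<in> N \<longrightarrow> ennreal (exp (a x)) = 0"
      using null_sets_density_iff[OF m, of N] by simp_all
    then have "AE x in \<mu>. x \<notin> N" by simp
    then show "N \<in> null_sets \<mu>" using AE_iff_null_sets[OF N(1)] by simp
  qed
  ultimately show ?thesis using a by (auto simp: stat_manifold_def)
qed

lemma bij_betw_phi_1:
  fixes B :: "'x::real_normed_vector set"
  assumes "open B" "prob_space \<mu>" "sets \<mu> = sets (restrict_space borel B)"
    and "\<And>A. open A \<Longrightarrow> A \<subseteq> B \<Longrightarrow> A \<noteq> {} \<Longrightarrow> measure \<mu> A > 0"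
  shows "bij_betw (phi_1 k B \<mu>) (stat_manifold k B \<mu>) (Cb k B)"
proof (rule bij_betw_byWitness[where f' = "\<lambda>a. density \<mu> (\<lambda>x. ennreal (exp (a x)))"])
  note 1 = phi_1_density[OF assms]
  have 2: "\<exists>a\<in>Cb k B. P = density \<mu> (\<lambda>x. ennreal (exp (a x)))"
    if "P \<in> stat_manifold k B \<mu>" for P
    using that by (simp add: stat_manifold_def)
  show "\<forall>P\<in>stat_manifold k B \<mu>. density \<mu> (\<lambda>x. ennreal (exp (phi_1 k B \<mu> P x))) = P"
    by (rule ballI, drule 2, elim bexE) (simp add: 1)
  show "\<forall>a\<in>Cb k B. phi_1 k B \<mu> (density \<mu> (\<lambda>x. ennreal (exp (a x)))) = a"
    by (simp add: 1)
  show "phi_1 k B \<mu> ` stat_manifold k B \<mu> \<subseteq> Cb k B"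
    by (rule image_subsetI, drule 2, elim bexE) (simp add: 1)
  show "(\<lambda>a. density \<mu> (\<lambda>x. ennreal (exp (a x)))) ` Cb k B \<subseteq> stat_manifold k B \<mu>"
    by (rule image_subsetI) (rule density_in_stat_manifold[OF assms(2,3)])
qed

end

theory Submission
  imports Defs
begin

text \<open>
  Write \<open>a\<close> and \<open>b\<close> for the charts of \<open>P\<close> and \<open>Q\<close>, and let \<open>\<beta> = (1 - \<alpha>) / 2\<close>, \<open>\<gamma> = (1 + \<alpha>) / 2\<close>, so that
  \<open>\<beta> + \<gamma> = 1\<close>. Since \<open>\<mu>\<close> has mass 1, most terms of the divergence cancel in the chart. For
  \<open>\<alpha> \<noteq> \<plusminus>1\<close> what is left is
  \<open>(1/\<gamma>) \<integral>exp a + (1/\<beta>) \<integral>exp b - (1/(\<beta>\<gamma>)) \<integral>exp (\<beta> a + \<gamma> b)\<close> (\<open>divergence_chart\<close>), and for \<open>\<alpha> = -1\<close>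
  it is \<open>\<integral>exp b + \<integral>exp a * (-1 + (a - b))\<close> (\<open>divergence_m1_chart\<close>). In all cases it is a linear
  combination of functions \<open>v \<mapsto> \<integral>exp (l v) * (c + m v)\<close>, where \<open>l\<close> and \<open>m\<close> are bounded linear maps
  from \<open>C\<^sub>b\<^sup>k \<times> C\<^sub>b\<^sup>k\<close> to the bounded measurable functions on \<open>B\<close>.

  Such a function is smooth because all its derivatives can be written down: differentiating under
  the integral gives \<open>exp (l v)\<close> times a polynomial in \<open>c + m v\<close> and the values of \<open>l\<close> and \<open>m\<close> on the
  directions, and the second-order remainder of the exponential is bounded uniformly in the point
  of \<open>B\<close> (\<open>exp_derivative_has_derivative\<close>). The uniformity comes from the boundedness of the
  evaluations, \<open>\<bar>a x\<bar> \<le> \<parallel>a\<parallel>\<close> (\<open>abs_le_Cb_norm\<close>).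

  Two facts connect explicit derivatives with the definition of smoothness, where the derivatives
  are chosen by a choice operator. Derivatives are unique on open sets, so a sequence of forms
  in which each is a derivative of the one before consists of the chosen ones
  (\<open>nth_derivative_eq_tower\<close>); and each member of such a sequence is continuous because it is
  differentiable (\<open>C_infinity_onI\<close>). Uniqueness on the open set \<open>B\<close> also shows that taking
  derivatives is linear, which is what makes \<open>C\<^sub>b\<^sup>k\<close> a vector space and its norm homogeneous.
\<close>

section \<open>Calculus of multilinear forms\<close>

text \<open>
  Bounds on multilinear forms and uniqueness of derivatives come from scaling the arguments, so
  homogeneity is the property of a norm that carries the calculus below. The inequality
  \<open>N (c *\<^sub>R v) \<le> \<bar>c\<bar> * N v\<close> is an equality: for \<open>c \<noteq> 0\<close> apply it to \<open>c *\<^sub>R v\<close> and \<open>1 / c\<close>.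
\<close>

locale gauge_space =
  fixes V :: "'v::real_vector set" and N :: "'v \<Rightarrow> real"
  assumes subspace_V: "subspace V"
    and N_nonneg: "v \<in> V \<Longrightarrow> 0 \<le> N v"
    and N_scale: "v \<in> V \<Longrightarrow> N (c *\<^sub>R v) \<le> \<bar>c\<bar> * N v"
begin

abbreviation forms :: "nat \<Rightarrow> ('v list \<Rightarrow> real) set"
  where "forms \<equiv> multilinear_forms V N"

lemma add_V: "v \<in> V \<Longrightarrow> w \<in> V \<Longrightarrow> v + w \<in> V"
  and scale_V: "v \<in> V \<Longrightarrow> c *\<^sub>R v \<in> V"
  and zero_V: "0 \<in> V"
  using subspace_V by (auto simp: subspace_def)

lemma diff_V: "v \<in> V \<Longrightarrow> w \<in> V \<Longrightarrow> v - w \<in> V"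
  using subspace_V by (rule subspace_diff)

lemma N_zero: "N 0 = 0"
  using N_scale[OF zero_V, of 0] N_nonneg[OF zero_V] by simp

lemma prod_N_nonneg:
  "set vs \<subseteq> V \<Longrightarrow> 0 \<le> (\<Prod>v\<leftarrow>vs. N v)"
  by (induction vs) (auto intro!: mult_nonneg_nonneg N_nonneg)

lemma prod_N_le_1:
  "set vs \<subseteq> V \<Longrightarrow> \<forall>v\<in>set vs. N v \<le> 1 \<Longrightarrow> (\<Prod>v\<leftarrow>vs. N v) \<le> 1"
  by (induction vs) (auto intro!: mult_le_one N_nonneg prod_N_nonneg)

lemma formsI:
  assumes "\<And>vs. \<not> (length vs = i \<and> set vs \<subseteq> V) \<Longrightarrow> m vs = 0"
    and "\<And>vs j v w. length vs = i \<Longrightarrow> set vs \<subseteq> V \<Longrightarrow> j < i \<Longrightarrow> v \<in> V \<Longrightarrow> w \<in> V \<Longrightarrow>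
      m (vs[j := v + w]) = m (vs[j := v]) + m (vs[j := w])"
    and "\<And>vs j c v. length vs = i \<Longrightarrow> set vs \<subseteq> V \<Longrightarrow> j < i \<Longrightarrow> v \<in> V \<Longrightarrow>
      m (vs[j := c *\<^sub>R v]) = c * m (vs[j := v])"
    and "\<And>vs. length vs = i \<Longrightarrow> set vs \<subseteq> V \<Longrightarrow> \<bar>m vs\<bar> \<le> C * (\<Prod>v\<leftarrow>vs. N v)"
  shows "m \<in> forms i"
  using assms unfolding multilinear_forms_def by blast

lemma forms_outside:
  "m \<in> forms i \<Longrightarrow> \<not> (length vs = i \<and> set vs \<subseteq> V) \<Longrightarrow> m vs = 0"
  unfolding multilinear_forms_def by blast

lemma forms_scale:
  assumes "m \<in> forms i" "length vs = i" "set vs \<subseteq> V" "j < i" "v \<in> V"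
  shows "m (vs[j := c *\<^sub>R v]) = c * m (vs[j := v])"
  using assms unfolding multilinear_forms_def by blast

lemma forms_add:
  assumes "m \<in> forms i" "length vs = i" "set vs \<subseteq> V" "j < i" "v \<in> V" "w \<in> V"
  shows "m (vs[j := v + w]) = m (vs[j := v]) + m (vs[j := w])"
  using assms unfolding multilinear_forms_def by blast

lemma forms_bound:
  assumes "m \<in> forms i"
  obtains C where "C \<ge> 0" "\<And>vs. length vs = i \<Longrightarrow> set vs \<subseteq> V \<Longrightarrow> \<bar>m vs\<bar> \<le> C * (\<Prod>v\<leftarrow>vs. N v)"
proof -
  obtain C where C: "\<And>vs. length vs = i \<Longrightarrow> set vs \<subseteq> V \<Longrightarrow> \<bar>m vs\<bar> \<le> C * (\<Prod>v\<leftarrow>vs. N v)"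
    using assms unfolding multilinear_forms_def by blast
  have "\<bar>m vs\<bar> \<le> \<bar>C\<bar> * (\<Prod>v\<leftarrow>vs. N v)" if "length vs = i" "set vs \<subseteq> V" for vs
    by (rule order_trans[OF C[OF that]] mult_right_mono prod_N_nonneg that abs_ge_self)+
  then show thesis using that[of "\<bar>C\<bar>"] by simp
qed

lemma forms_lincomb:
  assumes m: "m \<in> forms i" and m': "m' \<in> forms i"
  shows "(\<lambda>vs. c * m vs + d * m' vs) \<in> forms i"
proof -
  obtain C where C: "\<And>vs. length vs = i \<Longrightarrow> set vs \<subseteq> V \<Longrightarrow> \<bar>m vs\<bar> \<le> C * (\<Prod>v\<leftarrow>vs. N v)"
    by (rule forms_bound[OF m]) blast
  obtain D where D: "\<And>vs. length vs = i \<Longrightarrow> set vs \<subseteq> V \<Longrightarrow> \<bar>m' vs\<bar> \<le> D * (\<Prod>v\<leftarrow>vs. N v)"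
    by (rule forms_bound[OF m']) blast
  show ?thesis
  proof (rule formsI[where C = "\<bar>c\<bar> * C + \<bar>d\<bar> * D"], goal_cases)
    case (4 vs)
    have "\<bar>c * m vs + d * m' vs\<bar> \<le> \<bar>c\<bar> * \<bar>m vs\<bar> + \<bar>d\<bar> * \<bar>m' vs\<bar>"
      by (metis abs_mult abs_triangle_ineq)
    also have "\<dots> \<le> \<bar>c\<bar> * (C * (\<Prod>v\<leftarrow>vs. N v)) + \<bar>d\<bar> * (D * (\<Prod>v\<leftarrow>vs. N v))"
      by (intro add_mono mult_left_mono C D 4) auto
    finally show ?case by (simp add: algebra_simps)
  qed (auto simp: forms_outside[OF m] forms_outside[OF m'] forms_add[OF m] forms_add[OF m']
      forms_scale[OF m] forms_scale[OF m'] algebra_simps)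
qed

lemma forms_diff:
  assumes "m \<in> forms i" "m' \<in> forms i"
  shows "(\<lambda>vs. m vs - m' vs) \<in> forms i"
  using forms_lincomb[OF assms, of 1 "-1"] by simp

lemma forms_curry:
  assumes m: "m \<in> forms (Suc i)" and h: "h \<in> V"
  shows "(\<lambda>vs. m (h # vs)) \<in> forms i"
proof -
  obtain C where C: "\<And>vs. length vs = Suc i \<Longrightarrow> set vs \<subseteq> V \<Longrightarrow> \<bar>m vs\<bar> \<le> C * (\<Prod>v\<leftarrow>vs. N v)"
    by (rule forms_bound[OF m]) blast
  show ?thesis
  proof (rule formsI[where C = "C * N h"], goal_cases)
    case 1 then show ?case using forms_outside[OF m] by auto
  next
    case (2 vs j v w)
    then show ?case using forms_add[OF m, of "h # vs" "Suc j" v w] h by simp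
  next
    case (3 vs j c v)
    then show ?case using forms_scale[OF m, of "h # vs" "Suc j" v c] h by simp
  next
    case (4 vs) then show ?case using C[of "h # vs"] h by (simp add: mult.assoc)
  qed
qed

lemma forms_map_scale:
  assumes m: "m \<in> forms i" and vs: "length vs = i" "set vs \<subseteq> V"
  shows "m (map ((*\<^sub>R) c) vs) = c ^ i * m vs"
  using assms
proof (induction i arbitrary: m vs)
  case (Suc i)
  then obtain w ws where [simp]: "vs = w # ws" by (cases vs) auto
  have w: "w \<in> V" "length ws = i" "set ws \<subseteq> V" using Suc.prems by auto
  have "m (map ((*\<^sub>R) c) vs) = m ((c *\<^sub>R w) # map ((*\<^sub>R) c) ws)" by simp
  also have "\<dots> = c ^ i * m ((c *\<^sub>R w) # ws)"
    by (rule Suc.IH[OF forms_curry[OF Suc.prems(1)]]) (use w scale_V in auto)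
  also have "m ((c *\<^sub>R w) # ws) = c * m (w # ws)"
    using forms_scale[OF Suc.prems(1), of "w # ws" 0 w c] w by simp
  finally show ?case by simp
qed simp

subsection \<open>The operator norm\<close>

abbreviation unit_lists :: "nat \<Rightarrow> 'v list set"
  where "unit_lists i \<equiv> {vs. length vs = i \<and> set vs \<subseteq> V \<and> (\<forall>v\<in>set vs. N v \<le> 1)}"

lemma unit_lists_nonempty: "unit_lists i \<noteq> {}"
proof -
  have "replicate i 0 \<in> unit_lists i" using zero_V N_zero by auto
  then show ?thesis by blast
qed

lemma abs_le_form_norm:
  assumes m: "m \<in> forms i" and vs: "vs \<in> unit_lists i"
  shows "\<bar>m vs\<bar> \<le> form_norm V N i m"
  unfolding form_norm_def
proof (rule cSUP_upper[OF vs])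
  obtain C where C: "C \<ge> 0"
    "\<And>vs. length vs = i \<Longrightarrow> set vs \<subseteq> V \<Longrightarrow> \<bar>m vs\<bar> \<le> C * (\<Prod>v\<leftarrow>vs. N v)"
    by (rule forms_bound[OF m]) blast
  show "bdd_above ((\<lambda>vs. \<bar>m vs\<bar>) ` unit_lists i)"
  proof (rule bdd_aboveI2[where M = C])
    fix vs assume "vs \<in> unit_lists i"
    then have "\<bar>m vs\<bar> \<le> C * (\<Prod>v\<leftarrow>vs. N v)" "C * (\<Prod>v\<leftarrow>vs. N v) \<le> C * 1"
      by (auto intro!: C mult_left_le prod_N_le_1)
    then show "\<bar>m vs\<bar> \<le> C" by simp
  qed
qed

lemma form_norm_le:
  assumes "\<And>vs. vs \<in> unit_lists i \<Longrightarrow> \<bar>m vs\<bar> \<le> C"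
  shows "form_norm V N i m \<le> C"
  unfolding form_norm_def by (rule cSUP_least[OF unit_lists_nonempty assms])

lemma form_norm_le_bound:
  assumes "\<And>vs. length vs = i \<Longrightarrow> set vs \<subseteq> V \<Longrightarrow> \<bar>m vs\<bar> \<le> C * (\<Prod>v\<leftarrow>vs. N v)" and "0 \<le> C"
  shows "form_norm V N i m \<le> C"
proof (rule form_norm_le)
  fix vs assume "vs \<in> unit_lists i"
  then have "\<bar>m vs\<bar> \<le> C * (\<Prod>v\<leftarrow>vs. N v)" "C * (\<Prod>v\<leftarrow>vs. N v) \<le> C * 1"
    by (auto intro!: assms mult_left_le prod_N_le_1)
  then show "\<bar>m vs\<bar> \<le> C" by simp
qed

lemma form_norm_nonneg:
  assumes "m \<in> forms i"
  shows "0 \<le> form_norm V N i m"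
proof -
  obtain vs where "vs \<in> unit_lists i" using unit_lists_nonempty by blast
  from abs_le_form_norm[OF assms this] show ?thesis by linarith
qed

lemma form_norm_lincomb:
  assumes m: "m \<in> forms i" "m' \<in> forms i"
  shows "form_norm V N i (\<lambda>vs. c * m vs + d * m' vs)
    \<le> \<bar>c\<bar> * form_norm V N i m + \<bar>d\<bar> * form_norm V N i m'"
proof (rule form_norm_le)
  fix vs assume vs: "vs \<in> unit_lists i"
  have "\<bar>c * m vs + d * m' vs\<bar> \<le> \<bar>c\<bar> * \<bar>m vs\<bar> + \<bar>d\<bar> * \<bar>m' vs\<bar>"
    by (metis abs_mult abs_triangle_ineq)
  also have "\<dots> \<le> \<bar>c\<bar> * form_norm V N i m + \<bar>d\<bar> * form_norm V N i m'"
    by (intro add_mono mult_left_mono abs_le_form_norm[OF _ vs] m) auto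
  finally show "\<bar>c * m vs + d * m' vs\<bar> \<le> \<dots>" .
qed

subsection \<open>Derivatives\<close>

text \<open>
  Openness relative to \<open>V\<close>, for the topology given by \<open>N\<close>.
\<close>

definition gauge_open :: "'v set \<Rightarrow> bool"
  where "gauge_open U \<longleftrightarrow> (\<forall>x\<in>U. \<exists>r>0. \<forall>h\<in>V. N h < r \<longrightarrow> x + h \<in> U)"

lemma has_form_derivative_cong:
  assumes "\<And>y. y \<in> U \<Longrightarrow> A y = A' y" "x \<in> U"
  shows "has_form_derivative V N U i A D x \<longleftrightarrow> has_form_derivative V N U i A' D x"
  unfolding has_form_derivative_def using assms by (simp cong: conj_cong imp_cong)

lemma form_continuous_cong:
  assumes "\<And>y. y \<in> U \<Longrightarrow> A y = A' y"
  shows "form_continuous V N U i A \<longleftrightarrow> form_continuous V N U i A'"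
  unfolding form_continuous_def using assms by (simp cong: conj_cong imp_cong)

lemma has_form_derivative_lincomb:
  assumes A: "\<And>y. y \<in> U \<Longrightarrow> A y \<in> forms i" and B: "\<And>y. y \<in> U \<Longrightarrow> B y \<in> forms i"
    and x: "x \<in> U"
    and A': "has_form_derivative V N U i A A' x" and B': "has_form_derivative V N U i B B' x"
  shows "has_form_derivative V N U i (\<lambda>y vs. c * A y vs + d * B y vs)
    (\<lambda>vs. c * A' vs + d * B' vs) x"
proof -
  have fA: "A' \<in> forms (Suc i)" and fB: "B' \<in> forms (Suc i)"
    using A' B' by (auto simp: has_form_derivative_def)
  show ?thesis
    unfolding has_form_derivative_def
  proof (intro conjI allI impI)
    show "(\<lambda>vs. c * A' vs + d * B' vs) \<in> forms (Suc i)"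
      by (rule forms_lincomb[OF fA fB])
    fix \<epsilon> :: real assume "\<epsilon> > 0"
    define e where "e = \<epsilon> / (\<bar>c\<bar> + \<bar>d\<bar> + 1)"
    have e: "e > 0" "(\<bar>c\<bar> + \<bar>d\<bar>) * e \<le> \<epsilon>"
      using \<open>\<epsilon> > 0\<close> by (auto simp: e_def field_simps)
    obtain r where r: "r > 0" "\<And>h. h \<in> V \<Longrightarrow> x + h \<in> U \<Longrightarrow> N h < r \<Longrightarrow>
        form_norm V N i (\<lambda>vs. A (x + h) vs - A x vs - A' (h # vs)) \<le> e * N h"
      using A' e(1) unfolding has_form_derivative_def by blast
    obtain s where s: "s > 0" "\<And>h. h \<in> V \<Longrightarrow> x + h \<in> U \<Longrightarrow> N h < s \<Longrightarrow>
        form_norm V N i (\<lambda>vs. B (x + h) vs - B x vs - B' (h # vs)) \<le> e * N h"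
      using B' e(1) unfolding has_form_derivative_def by blast
    show "\<exists>\<delta>>0. \<forall>h\<in>V. x + h \<in> U \<and> N h < \<delta> \<longrightarrow> form_norm V N i (\<lambda>vs.
        c * A (x + h) vs + d * B (x + h) vs - (c * A x vs + d * B x vs) -
        (c * A' (h # vs) + d * B' (h # vs))) \<le> \<epsilon> * N h"
    proof (intro exI[of _ "min r s"] conjI ballI impI)
      show "min r s > 0" using r s by simp
      fix h assume h: "h \<in> V" "x + h \<in> U \<and> N h < min r s"
      let ?a = "\<lambda>vs. A (x + h) vs - A x vs - A' (h # vs)"
      let ?b = "\<lambda>vs. B (x + h) vs - B x vs - B' (h # vs)"
      have "?a \<in> forms i" "?b \<in> forms i"
        using h by (auto intro!: forms_diff forms_curry A B fA fB x)
      then have "form_norm V N i (\<lambda>vs. c * ?a vs + d * ?b vs)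
          \<le> \<bar>c\<bar> * form_norm V N i ?a + \<bar>d\<bar> * form_norm V N i ?b"
        by (rule form_norm_lincomb)
      also have "\<dots> \<le> \<bar>c\<bar> * (e * N h) + \<bar>d\<bar> * (e * N h)"
        using h r s by (intro add_mono mult_left_mono) auto
      also have "\<dots> = ((\<bar>c\<bar> + \<bar>d\<bar>) * e) * N h" by (simp add: algebra_simps)
      also have "\<dots> \<le> \<epsilon> * N h"
        by (intro mult_right_mono e N_nonneg h)
      finally show "form_norm V N i (\<lambda>vs.
        c * A (x + h) vs + d * B (x + h) vs - (c * A x vs + d * B x vs) -
        (c * A' (h # vs) + d * B' (h # vs))) \<le> \<epsilon> * N h"
        by (simp add: algebra_simps)
    qed
  qed
qed

text \<open>
  The error estimate controls \<open>D\<close> only on small first arguments and unit lists. Shrinking \<open>w\<close> by \<open>t\<close>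
  costs the same factor on both sides, and a common factor \<open>c\<close> brings all other arguments into the
  unit ball at once.
\<close>

lemma has_form_derivative_zero:
  assumes U: "gauge_open U" "x \<in> U"
    and D: "has_form_derivative V N U i (\<lambda>y vs. 0) D x"
  shows "D = (\<lambda>vs. 0)"
proof
  fix us
  have fD: "D \<in> forms (Suc i)" using D by (simp add: has_form_derivative_def)
  show "D us = 0"
  proof (cases "length us = Suc i \<and> set us \<subseteq> V")
    case True
    then obtain w ws where [simp]: "us = w # ws" and w: "w \<in> V" "length ws = i" "set ws \<subseteq> V"
      by (cases us) auto
    \<comment> \<open>The sum bounds all entries of \<open>ws\<close>; the summand 1 keeps \<open>c\<close> finite.\<close>
    define c where "c = 1 / (1 + (\<Sum>v\<leftarrow>ws. N v))"
    have S: "0 \<le> (\<Sum>v\<leftarrow>ws. N v)"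
      using w N_nonneg by (intro sum_list_nonneg) auto
    then have c: "c > 0" by (simp add: c_def)
    have cN: "c * N v \<le> 1" if "v \<in> set ws" for v
    proof -
      have "N v \<le> (\<Sum>v\<leftarrow>ws. N v)"
        using that w N_nonneg by (intro member_le_sum_list) auto
      then show ?thesis using S by (simp add: c_def field_simps)
    qed
    have unit: "map ((*\<^sub>R) c) ws \<in> unit_lists i"
      using w c cN by (auto intro!: scale_V order_trans[OF N_scale])
    obtain r where r: "r > 0" "\<And>h. h \<in> V \<Longrightarrow> N h < r \<Longrightarrow> x + h \<in> U"
      using U by (auto simp: gauge_open_def)
    have Nw: "0 \<le> N w" using N_nonneg w by simp
    have "c ^ i * \<bar>D us\<bar> \<le> e * N w" if e: "e > 0" for e
    proof -
      obtain s where s: "s > 0" "\<And>h. h \<in> V \<Longrightarrow> x + h \<in> U \<Longrightarrow> N h < s \<Longrightarrow>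
          form_norm V N i (\<lambda>vs. 0 - 0 - D (h # vs)) \<le> e * N h"
        using D e unfolding has_form_derivative_def by blast
      define t where "t = min r s / (1 + N w)"
      have t: "t > 0" using r s Nw by (simp add: t_def)
      have "t * N w < t * (1 + N w)" using t by simp
      also have "\<dots> = min r s" using Nw by (simp add: t_def)
      finally have tN: "t * N w < min r s" .
      let ?h = "t *\<^sub>R w"
      have Nh: "N ?h \<le> t * N w" using N_scale[of w t] w t by simp
      have h: "?h \<in> V" using w scale_V by simp
      have fh: "(\<lambda>vs. 0 - 0 - D (?h # vs)) \<in> forms i"
        using forms_lincomb[OF forms_curry[OF fD h] forms_curry[OF fD h], of "-1" 0] by simp
      have "\<bar>0 - 0 - D (?h # map ((*\<^sub>R) c) ws)\<bar> \<le> form_norm V N i (\<lambda>vs. 0 - 0 - D (?h # vs))"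
        by (rule abs_le_form_norm[OF fh unit])
      also have "\<dots> \<le> e * N ?h" 
        using s(2)[OF h r(2)[OF h]] tN Nh by linarith
      also have "\<dots> \<le> e * (t * N w)" using Nh e by simp
      also have "D (?h # map ((*\<^sub>R) c) ws) = c ^ i * D (?h # ws)"
        by (rule forms_map_scale[OF forms_curry[OF fD h] w(2,3)])
      also have "D (?h # ws) = t * D us"
        using forms_scale[OF fD, of "w # ws" 0 w t] w by simp
      finally have "t * (c ^ i * \<bar>D us\<bar>) \<le> t * (e * N w)"
        using t c by (simp add: abs_mult algebra_simps)
      then show ?thesis using t by simp
    qed
    note le = this
    have "c ^ i * \<bar>D us\<bar> \<le> 0"
    proof (rule field_le_epsilon)
      fix e :: real assume e: "e > 0"
      have pos: "e / (1 + N w) > 0" using e Nw by simp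
      have "e / (1 + N w) * N w \<le> e / (1 + N w) * (1 + N w)"
        by (rule mult_left_mono) (use pos in auto)
      also have "\<dots> = 0 + e" using Nw by simp
      finally have "e / (1 + N w) * N w \<le> 0 + e" .
      with le[OF pos] have "c ^ i * \<bar>D us\<bar> \<le> 0 + e" by (rule order_trans)
      then show "c ^ i * \<bar>D us\<bar> \<le> 0 + e" .
    qed
    moreover have "c ^ i > 0" using c by simp
    ultimately show ?thesis by (simp add: mult_le_0_iff)
  qed (use forms_outside[OF fD] in blast)
qed

lemma has_form_derivative_unique:
  assumes U: "gauge_open U" "x \<in> U" and A: "\<And>y. y \<in> U \<Longrightarrow> A y \<in> forms i"
    and D: "has_form_derivative V N U i A D x" and D': "has_form_derivative V N U i A D' x"
  shows "D = D'"
proof -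
  have "has_form_derivative V N U i (\<lambda>y vs. 1 * A y vs + -1 * A y vs)
    (\<lambda>vs. 1 * D vs + -1 * D' vs) x"
    by (rule has_form_derivative_lincomb[OF A A U(2) D D'])
  then have "(\<lambda>vs. D vs - D' vs) = (\<lambda>vs. 0)"
    by (intro has_form_derivative_zero[OF U]) simp
  then show ?thesis by (simp add: fun_eq_iff)
qed

lemma form_continuous_lincomb:
  assumes A: "\<And>y. y \<in> U \<Longrightarrow> A y \<in> forms i" and B: "\<And>y. y \<in> U \<Longrightarrow> B y \<in> forms i"
    and A': "form_continuous V N U i A" and B': "form_continuous V N U i B"
  shows "form_continuous V N U i (\<lambda>y vs. c * A y vs + d * B y vs)"
  unfolding form_continuous_def
proof (intro ballI allI impI)
  fix x and \<epsilon> :: real assume x: "x \<in> U" and "\<epsilon> > 0"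
  define e where "e = \<epsilon> / (\<bar>c\<bar> + \<bar>d\<bar> + 1)"
  have e: "e > 0" "(\<bar>c\<bar> + \<bar>d\<bar>) * e < \<epsilon>"
    using \<open>\<epsilon> > 0\<close> by (auto simp: e_def field_simps)
  obtain r where r: "r > 0" "\<And>y. y \<in> U \<Longrightarrow> N (y - x) < r \<Longrightarrow>
      form_norm V N i (\<lambda>vs. A y vs - A x vs) < e"
    using A' e(1) x unfolding form_continuous_def by blast
  obtain s where s: "s > 0" "\<And>y. y \<in> U \<Longrightarrow> N (y - x) < s \<Longrightarrow>
      form_norm V N i (\<lambda>vs. B y vs - B x vs) < e"
    using B' e(1) x unfolding form_continuous_def by blast
  show "\<exists>\<delta>>0. \<forall>y\<in>U. N (y - x) < \<delta> \<longrightarrow> form_norm V N i (\<lambda>vs.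
      c * A y vs + d * B y vs - (c * A x vs + d * B x vs)) < \<epsilon>"
  proof (intro exI[of _ "min r s"] conjI ballI impI)
    show "min r s > 0" using r s by simp
    fix y assume y: "y \<in> U" "N (y - x) < min r s"
    let ?a = "\<lambda>vs. A y vs - A x vs" and ?b = "\<lambda>vs. B y vs - B x vs"
    have "?a \<in> forms i" "?b \<in> forms i"
      using y by (auto intro!: forms_diff A B x)
    then have "form_norm V N i (\<lambda>vs. c * ?a vs + d * ?b vs)
        \<le> \<bar>c\<bar> * form_norm V N i ?a + \<bar>d\<bar> * form_norm V N i ?b"
      by (rule form_norm_lincomb)
    also have "\<dots> \<le> \<bar>c\<bar> * e + \<bar>d\<bar> * e"
      using less_imp_le[OF r(2)[OF y(1)]] less_imp_le[OF s(2)[OF y(1)]] y(2)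
      by (intro add_mono mult_left_mono) auto
    also have "\<dots> < \<epsilon>" using e by (simp add: algebra_simps)
    finally show "form_norm V N i (\<lambda>vs.
      c * A y vs + d * B y vs - (c * A x vs + d * B x vs)) < \<epsilon>"
      by (simp add: algebra_simps)
  qed
qed

lemma has_form_derivative_imp_continuous:
  assumes U: "U \<subseteq> V" and A: "\<And>y. y \<in> U \<Longrightarrow> A y \<in> forms i"
    and D: "\<And>x. x \<in> U \<Longrightarrow> has_form_derivative V N U i A (D x) x"
  shows "form_continuous V N U i A"
  unfolding form_continuous_def
proof (intro ballI allI impI)
  fix x and \<epsilon> :: real assume x: "x \<in> U" and \<epsilon>: "\<epsilon> > 0"
  have fD: "D x \<in> forms (Suc i)" using D[OF x] by (simp add: has_form_derivative_def)
  obtain C where C: "C \<ge> 0"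
    "\<And>vs. length vs = Suc i \<Longrightarrow> set vs \<subseteq> V \<Longrightarrow> \<bar>D x vs\<bar> \<le> C * (\<Prod>v\<leftarrow>vs. N v)"
    by (rule forms_bound[OF fD]) blast
  obtain r where r: "r > 0" "\<And>h. h \<in> V \<Longrightarrow> x + h \<in> U \<Longrightarrow> N h < r \<Longrightarrow>
      form_norm V N i (\<lambda>vs. A (x + h) vs - A x vs - D x (h # vs)) \<le> 1 * N h"
    using D[OF x] zero_less_one unfolding has_form_derivative_def by blast
  show "\<exists>\<delta>>0. \<forall>y\<in>U. N (y - x) < \<delta> \<longrightarrow> form_norm V N i (\<lambda>vs. A y vs - A x vs) < \<epsilon>"
  proof (intro exI[of _ "min r (\<epsilon> / (1 + C))"] conjI ballI impI)
    show "min r (\<epsilon> / (1 + C)) > 0" using r \<epsilon> C by simp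
    fix y assume y: "y \<in> U" "N (y - x) < min r (\<epsilon> / (1 + C))"
    define h where "h = y - x"
    have h: "h \<in> V" "x + h = y" using x y U by (auto simp: h_def intro!: diff_V)
    have Dh: "(\<lambda>vs. D x (h # vs)) \<in> forms i" by (rule forms_curry[OF fD h(1)])
    let ?a = "\<lambda>vs. A y vs - A x vs - D x (h # vs)"
    have "?a \<in> forms i" by (intro forms_diff A x y Dh)
    then have "form_norm V N i (\<lambda>vs. 1 * ?a vs + 1 * D x (h # vs))
        \<le> \<bar>1\<bar> * form_norm V N i ?a + \<bar>1\<bar> * form_norm V N i (\<lambda>vs. D x (h # vs))"
      by (rule form_norm_lincomb[OF _ Dh])
    also have "form_norm V N i ?a \<le> N h" using r(2)[of h] h y by (simp add: h_def)
    also have "form_norm V N i (\<lambda>vs. D x (h # vs)) \<le> C * N h"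
      using C(2)[of "h # _"] h(1) C(1) N_nonneg[OF h(1)]
      by (intro form_norm_le_bound) (auto simp: mult.assoc)
    finally have "form_norm V N i (\<lambda>vs. A y vs - A x vs) \<le> (1 + C) * N h"
      by (simp add: algebra_simps)
    also have "\<dots> < \<epsilon>" using y C by (simp add: h_def field_simps)
    finally show "form_norm V N i (\<lambda>vs. A y vs - A x vs) < \<epsilon>" .
  qed
qed

lemma gauge_open_V: "gauge_open V"
  unfolding gauge_open_def using add_V zero_less_one by blast

subsection \<open>Towers of derivatives\<close>

definition derivative_tower ::
    "nat \<Rightarrow> 'v set \<Rightarrow> ('v \<Rightarrow> real) \<Rightarrow> (nat \<Rightarrow> 'v \<Rightarrow> 'v list \<Rightarrow> real) \<Rightarrow> bool"
  where "derivative_tower k U f A \<longleftrightarrow>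
     (\<forall>x\<in>U. A 0 x = (\<lambda>vs. if vs = [] then f x else 0)) \<and>
     (\<forall>i<k. \<forall>x\<in>U. has_form_derivative V N U i (A i) (A (Suc i) x) x)"

lemma tower_forms:
  assumes "derivative_tower k U f A" "i \<le> k" "x \<in> U"
  shows "A i x \<in> forms i"
proof (cases i)
  case 0
  then have "A i x = (\<lambda>vs. if vs = [] then f x else 0)"
    using assms by (simp add: derivative_tower_def)
  then show ?thesis
    using 0 by (intro formsI[where C = "\<bar>f x\<bar>"]) (auto split: if_splits)
next
  case (Suc j)
  then show ?thesis
    using assms unfolding derivative_tower_def has_form_derivative_def by auto
qed

text \<open>
  By induction, the choice in each step is made from a set with a single element.
\<close>

lemma nth_derivative_eq_tower:
  assumes U: "gauge_open U" and A: "derivative_tower k U f A"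
  shows "i \<le> k \<Longrightarrow> x \<in> U \<Longrightarrow> nth_derivative V N U f i x = A i x"
proof (induction i arbitrary: x)
  case 0
  then show ?case using A by (simp add: derivative_tower_def)
next
  case (Suc i)
  let ?d = "nth_derivative V N U f i"
  have eq: "\<And>y. y \<in> U \<Longrightarrow> ?d y = A i y" using Suc by simp
  have "has_form_derivative V N U i (A i) (A (Suc i) x) x"
    using A Suc.prems by (simp add: derivative_tower_def)
  moreover have "has_form_derivative V N U i ?d D x \<longleftrightarrow> has_form_derivative V N U i (A i) D x" for D
    by (rule has_form_derivative_cong[OF eq Suc.prems(2)])
  moreover have "D = A (Suc i) x" if "has_form_derivative V N U i (A i) D x" for D
  proof (rule has_form_derivative_unique[OF U Suc.prems(2) _ that calculation(1)])
    fix y assume "y \<in> U"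
    then show "A i y \<in> forms i" using tower_forms[OF A, of i y] Suc.prems(1) by simp
  qed
  ultimately have "(SOME D. has_form_derivative V N U i ?d D x) = A (Suc i) x"
    by (metis (no_types, lifting) some_equality)
  then show ?case by simp
qed

lemma C_k_onI:
  assumes U: "gauge_open U" and A: "derivative_tower k U f A"
    and c: "\<And>i. i \<le> k \<Longrightarrow> form_continuous V N U i (A i)"
  shows "C_k_on V N k U f"
  unfolding C_k_on_def
proof (intro conjI allI impI ballI)
  fix i x assume i: "i < k" "x \<in> U"
  then have "has_form_derivative V N U i (A i) (A (Suc i) x) x"
    using A by (simp add: derivative_tower_def)
  moreover have "has_form_derivative V N U i (nth_derivative V N U f i) (A (Suc i) x) x \<longleftrightarrow>
      has_form_derivative V N U i (A i) (A (Suc i) x) x"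
    by (rule has_form_derivative_cong[OF _ i(2)])
      (rule nth_derivative_eq_tower[OF U A less_imp_le[OF i(1)]])
  ultimately show "\<exists>D. has_form_derivative V N U i (nth_derivative V N U f i) D x"
    by blast
next
  fix i assume i: "i \<le> k"
  have "form_continuous V N U i (nth_derivative V N U f i) \<longleftrightarrow> form_continuous V N U i (A i)"
    by (rule form_continuous_cong) (rule nth_derivative_eq_tower[OF U A i])
  then show "form_continuous V N U i (nth_derivative V N U f i)"
    using c[OF i] by blast
qed

lemma C_k_on_tower:
  assumes "C_k_on V N k U f"
  shows "derivative_tower k U f (nth_derivative V N U f)"
  unfolding derivative_tower_def
proof (intro conjI allI impI ballI)
  fix i x assume "i < k" "x \<in> U"
  then show "has_form_derivative V N U i (nth_derivative V N U f i)
      (nth_derivative V N U f (Suc i) x) x"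
    using assms unfolding C_k_on_def nth_derivative.simps(2) by (metis someI_ex)
qed simp

text \<open>
  Each level of an infinite tower is differentiable, hence continuous.
\<close>

lemma C_infinity_onI:
  assumes U: "gauge_open U" "U \<subseteq> V" and A: "\<And>k. derivative_tower k U f A"
  shows "C_infinity_on V N U f"
  unfolding C_infinity_on_def
proof (intro allI C_k_onI[OF U(1) A])
  fix i
  show "form_continuous V N U i (A i)"
  proof (rule has_form_derivative_imp_continuous[OF U(2)])
    fix x assume "x \<in> U"
    then show "has_form_derivative V N U i (A i) (A (Suc i) x) x"
      using A[of "Suc i"] unfolding derivative_tower_def by blast
  qed (rule tower_forms[OF A order_refl])
qed

lemma tower_lincomb:
  assumes A: "derivative_tower k U f A" and B: "derivative_tower k U g B"
  shows "derivative_tower k U (\<lambda>x. c * f x + d * g x) (\<lambda>i x vs. c * A i x vs + d * B i x vs)"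
  unfolding derivative_tower_def
proof (intro conjI allI impI ballI)
  fix i x assume i: "i < k" and x: "x \<in> U"
  show "has_form_derivative V N U i (\<lambda>x vs. c * A i x vs + d * B i x vs)
    (\<lambda>vs. c * A (Suc i) x vs + d * B (Suc i) x vs) x"
  proof (rule has_form_derivative_lincomb[OF _ _ x])
    show "has_form_derivative V N U i (A i) (A (Suc i) x) x"
      "has_form_derivative V N U i (B i) (B (Suc i) x) x"
      using A B i x unfolding derivative_tower_def by blast+
  qed (fact tower_forms[OF A less_imp_le[OF i]] tower_forms[OF B less_imp_le[OF i]])+
next
  fix x assume "x \<in> U"
  then have "A 0 x = (\<lambda>vs. if vs = [] then f x else 0)" "B 0 x = (\<lambda>vs. if vs = [] then g x else 0)"
    using A B unfolding derivative_tower_def by blast+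
  then show "(\<lambda>vs. c * A 0 x vs + d * B 0 x vs) = (\<lambda>vs. if vs = [] then c * f x + d * g x else 0)"
    by auto
qed

lemma tower_zero: "derivative_tower k U (\<lambda>x. 0) (\<lambda>i x vs. 0)"
proof -
  have "has_form_derivative V N U i (\<lambda>x vs. 0) (\<lambda>vs. 0) x" for i x
    unfolding has_form_derivative_def
    by (intro conjI formsI[where C = 0] allI impI exI[of _ 1] ballI form_norm_le_bound)
      (auto simp: N_nonneg prod_N_nonneg)
  then show ?thesis by (simp add: derivative_tower_def)
qed

lemma nth_derivative_lincomb:
  assumes "gauge_open U" "C_k_on V N k U f" "C_k_on V N k U g" "i \<le> k" "x \<in> U"
  shows "nth_derivative V N U (\<lambda>x. c * f x + d * g x) i x =
    (\<lambda>vs. c * nth_derivative V N U f i x vs + d * nth_derivative V N U g i x vs)"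
  by (rule nth_derivative_eq_tower[OF assms(1)
    tower_lincomb[OF C_k_on_tower[OF assms(2)] C_k_on_tower[OF assms(3)], of c d] assms(4,5)])

lemma C_k_on_lincomb:
  assumes U: "gauge_open U" and f: "C_k_on V N k U f" and g: "C_k_on V N k U g"
  shows "C_k_on V N k U (\<lambda>x. c * f x + d * g x)"
proof (rule C_k_onI[OF U tower_lincomb[OF C_k_on_tower[OF f] C_k_on_tower[OF g], of c d]])
  fix i assume i: "i \<le> k"
  show "form_continuous V N U i
    (\<lambda>x vs. c * nth_derivative V N U f i x vs + d * nth_derivative V N U g i x vs)"
  proof (rule form_continuous_lincomb)
    show "form_continuous V N U i (nth_derivative V N U f i)"
      "form_continuous V N U i (nth_derivative V N U g i)"
      using f g i unfolding C_k_on_def by blast+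
  qed (fact tower_forms[OF C_k_on_tower[OF f] i] tower_forms[OF C_k_on_tower[OF g] i])+
qed

lemma C_infinity_on_cong:
  assumes U: "gauge_open U" "U \<subseteq> V" and f: "C_infinity_on V N U f"
    and eq: "\<And>x. x \<in> U \<Longrightarrow> g x = f x"
  shows "C_infinity_on V N U g"
proof (rule C_infinity_onI[OF U])
  fix k
  have "derivative_tower k U f (nth_derivative V N U f)"
    using f C_k_on_tower unfolding C_infinity_on_def by blast
  then show "derivative_tower k U g (nth_derivative V N U f)"
    using eq unfolding derivative_tower_def by (auto simp: fun_eq_iff)
qed

lemma C_infinity_on_lincomb:
  assumes "gauge_open U" "C_infinity_on V N U f" "C_infinity_on V N U g"
  shows "C_infinity_on V N U (\<lambda>x. c * f x + d * g x)"
  unfolding C_infinity_on_def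
proof
  fix k
  show "C_k_on V N k U (\<lambda>x. c * f x + d * g x)"
    using assms(2,3) unfolding C_infinity_on_def by (intro C_k_on_lincomb assms(1)) simp_all
qed

end

section \<open>Integrals of exponentials\<close>

text \<open>
  The derivative of \<open>(u, q) \<mapsto> exp u * q\<close> in the directions \<open>ps\<close> is \<open>exp u * exp_coeff q ps\<close>: a further
  direction \<open>(s, t)\<close> multiplies by \<open>s\<close> (from the exponential) and replaces \<open>q\<close> by \<open>t\<close> (from the linear
  factor), where \<open>q\<close> occurs with the coefficient \<open>\<Prod>p\<leftarrow>ps. fst p\<close> (\<open>exp_coeff_add\<close>).
\<close>

primrec exp_coeff :: "real \<Rightarrow> (real \<times> real) list \<Rightarrow> real"
  where
    "exp_coeff q [] = q"
  | "exp_coeff q (p # ps) = fst p * exp_coeff q ps + snd p * (\<Prod>p\<leftarrow>ps. fst p)"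

lemma exp_coeff_add:
  "exp_coeff (q + t) ps = exp_coeff q ps + t * (\<Prod>p\<leftarrow>ps. fst p)"
  by (induction ps) (simp_all add: algebra_simps)

text \<open>
  The second components on the right are independent of \<open>b\<close> because \<open>exp_coeff_update_add\<close> updates
  both components at once and combines summands whose updates differ in them.
\<close>

lemma prod_list_update_add:
  "j < length ps \<Longrightarrow> (\<Prod>p\<leftarrow>ps[j := (a + a', b)]. fst p) =
    (\<Prod>p\<leftarrow>ps[j := (a, c)]. fst p) + (\<Prod>p\<leftarrow>ps[j := (a', d)]. (fst p :: real))"
  by (induction ps arbitrary: j) (auto simp: algebra_simps split: nat.split)

lemma prod_list_update_scale:
  "j < length ps \<Longrightarrow> (\<Prod>p\<leftarrow>ps[j := (r * a, b)]. fst p) =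
    r * (\<Prod>p\<leftarrow>ps[j := (a, c)]. (fst p :: real))"
  by (induction ps arbitrary: j) (auto simp: algebra_simps split: nat.split)

lemma exp_coeff_update_add:
  "j < length ps \<Longrightarrow> exp_coeff q (ps[j := (a + a', b + b')]) =
    exp_coeff q (ps[j := (a, b)]) + exp_coeff q (ps[j := (a', b')])"
proof (induction ps arbitrary: j)
  case (Cons p ps)
  then show ?case
    using prod_list_update_add[of "j - 1" ps a a' "b + b'" b b']
    by (cases j) (auto simp: algebra_simps)
qed simp

lemma exp_coeff_update_scale:
  "j < length ps \<Longrightarrow> exp_coeff q (ps[j := (r * a, r * b)]) = r * exp_coeff q (ps[j := (a, b)])"
proof (induction ps arbitrary: j)
  case (Cons p ps)
  then show ?case
    using prod_list_update_scale[of "j - 1" ps r a "r * b" b]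
    by (cases j) (auto simp: algebra_simps)
qed simp

lemma abs_prod_list_le:
  fixes f b :: "'a \<Rightarrow> real"
  assumes "\<And>v. v \<in> set vs \<Longrightarrow> \<bar>f v\<bar> \<le> b v"
  shows "\<bar>\<Prod>v\<leftarrow>vs. f v\<bar> \<le> (\<Prod>v\<leftarrow>vs. b v)"
  using assms
proof (induction vs)
  case (Cons v vs)
  then show ?case
    by (auto simp: abs_mult intro!: mult_mono order_trans[OF abs_ge_zero])
qed simp

lemma abs_exp_coeff_le:
  assumes "\<And>v. v \<in> set vs \<Longrightarrow> \<bar>f v\<bar> \<le> b v" "\<And>v. v \<in> set vs \<Longrightarrow> \<bar>g v\<bar> \<le> b v"
  shows "\<bar>exp_coeff q (map (\<lambda>v. (f v, g v)) vs)\<bar> \<le> (\<bar>q\<bar> + length vs) * (\<Prod>v\<leftarrow>vs. b v)"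
  using assms
proof (induction vs)
  case (Cons v vs)
  let ?e = "exp_coeff q (map (\<lambda>v. (f v, g v)) vs)" and ?B = "\<Prod>v\<leftarrow>vs. b v"
  have b: "0 \<le> b v" using Cons.prems(1)[of v] by simp
  have P: "\<bar>\<Prod>v\<leftarrow>vs. f v\<bar> \<le> ?B" using Cons.prems by (intro abs_prod_list_le) simp
  have "\<bar>exp_coeff q (map (\<lambda>v. (f v, g v)) (v # vs))\<bar> \<le> \<bar>f v\<bar> * \<bar>?e\<bar> + \<bar>g v\<bar> * \<bar>\<Prod>v\<leftarrow>vs. f v\<bar>"
    by (simp add: comp_def flip: abs_mult)
  also have "\<dots> \<le> b v * ((\<bar>q\<bar> + length vs) * ?B) + b v * ?B"
    using Cons P b by (intro add_mono mult_mono) auto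
  finally show ?case by (simp add: algebra_simps)
qed simp

lemma abs_exp_minus_one_le: "\<bar>exp s - 1\<bar> \<le> \<bar>s\<bar> * exp \<bar>s :: real\<bar>"
proof (cases "s \<ge> 0")
  case True
  have "(1 - s) * exp s \<le> exp (- s) * exp s"
    using exp_ge_add_one_self[of "- s"] by (intro mult_right_mono) auto
  then show ?thesis using True by (simp add: algebra_simps flip: exp_add)
next
  case False
  have "- s * 1 \<le> - s * exp \<bar>s\<bar>" using False by (intro mult_left_mono) auto
  then have "1 - exp s \<le> - s * exp \<bar>s\<bar>" using exp_ge_add_one_self[of s] by linarith
  moreover have "\<bar>exp s - 1\<bar> = 1 - exp s" "\<bar>s\<bar> = - s" using False by auto
  ultimately show ?thesis by simp
qed

lemma abs_exp_minus_affine_le: "\<bar>exp s - 1 - s\<bar> \<le> s\<^sup>2 * exp \<bar>s :: real\<bar>"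
proof -
  have "(1 - s) * exp s \<le> exp (- s) * exp s"
    using exp_ge_add_one_self[of "- s"] by (intro mult_right_mono) auto
  then have "exp s - 1 - s \<le> s * (exp s - 1)"
    by (simp add: algebra_simps flip: exp_add)
  also have "\<dots> \<le> \<bar>s\<bar> * (\<bar>s\<bar> * exp \<bar>s\<bar>)"
    using mult_left_mono[OF abs_exp_minus_one_le[of s] abs_ge_zero[of s]]
    by (metis abs_ge_self abs_mult order_trans)
  also have "\<dots> = s\<^sup>2 * exp \<bar>s\<bar>"
    by (simp add: power2_eq_square flip: mult.assoc)
  finally show ?thesis using exp_ge_add_one_self[of s] by linarith
qed

text \<open>
  As \<open>exp_coeff\<close> is affine in \<open>q\<close>, the left-hand side is
  \<open>exp u\<close> times \<open>exp_coeff q ps * (exp s - 1 - s) + t * (\<Prod>p\<leftarrow>ps. fst p) * (exp s - 1)\<close>, and both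
  summands are of second order in \<open>(s, t)\<close>.
\<close>

lemma exp_coeff_remainder:
  fixes u s q t :: real
  assumes s: "\<bar>s\<bar> \<le> \<eta>" and t: "\<bar>t\<bar> \<le> \<eta>"
    and E: "\<bar>exp_coeff q ps\<bar> \<le> E" and P: "\<bar>\<Prod>p\<leftarrow>ps. fst p\<bar> \<le> P"
  shows "\<bar>exp (u + s) * exp_coeff (q + t) ps - exp u * exp_coeff q ps
    - exp u * exp_coeff q ((s, t) # ps)\<bar> \<le> exp (\<bar>u\<bar> + \<eta>) * \<eta>\<^sup>2 * (E + P)"
proof -
  let ?e = "exp_coeff q ps" and ?p = "\<Prod>p\<leftarrow>ps. fst p"
  have \<eta>: "0 \<le> \<eta>" using s by simp
  have EP: "0 \<le> E" "0 \<le> P" using E P by linarith+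
  have s1: "\<bar>exp s - 1 - s\<bar> \<le> \<eta>\<^sup>2 * exp \<eta>"
  proof (rule order_trans[OF abs_exp_minus_affine_le mult_mono])
    show "s\<^sup>2 \<le> \<eta>\<^sup>2" using s by (metis abs_ge_zero power2_abs power_mono)
  qed (use s in auto)
  have s2: "\<bar>exp s - 1\<bar> \<le> \<eta> * exp \<eta>"
    by (rule order_trans[OF abs_exp_minus_one_le mult_mono]) (use s \<eta> in auto)
  have "exp (u + s) * exp_coeff (q + t) ps - exp u * ?e - exp u * exp_coeff q ((s, t) # ps)
    = exp u * (?e * (exp s - 1 - s) + t * (?p * (exp s - 1)))"
    by (simp add: exp_coeff_add exp_add algebra_simps)
  also have "\<bar>\<dots>\<bar> = exp u * \<bar>?e * (exp s - 1 - s) + t * (?p * (exp s - 1))\<bar>"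
    by (simp add: abs_mult)
  also have "\<dots> \<le> exp \<bar>u\<bar> * (E * (\<eta>\<^sup>2 * exp \<eta>) + \<eta> * (P * (\<eta> * exp \<eta>)))"
  proof (rule mult_mono)
    have "\<bar>?e * (exp s - 1 - s) + t * (?p * (exp s - 1))\<bar>
      \<le> \<bar>?e\<bar> * \<bar>exp s - 1 - s\<bar> + \<bar>t\<bar> * (\<bar>?p\<bar> * \<bar>exp s - 1\<bar>)"
      unfolding abs_mult[symmetric] by (rule abs_triangle_ineq)
    also have "\<dots> \<le> E * (\<eta>\<^sup>2 * exp \<eta>) + \<eta> * (P * (\<eta> * exp \<eta>))"
      using s1 s2 t E P \<eta> EP by (intro add_mono mult_mono) auto
    finally show "\<bar>?e * (exp s - 1 - s) + t * (?p * (exp s - 1))\<bar>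
      \<le> E * (\<eta>\<^sup>2 * exp \<eta>) + \<eta> * (P * (\<eta> * exp \<eta>))" .
  qed auto
  also have "\<dots> = exp (\<bar>u\<bar> + \<eta>) * \<eta>\<^sup>2 * (E + P)"
    by (simp add: exp_add power2_eq_square algebra_simps)
  finally show ?thesis .
qed

text \<open>
  A common constant \<open>K\<close> for \<open>l\<close> and \<open>m\<close> lets each direction \<open>w\<close> contribute one factor \<open>K * N w\<close>,
  whichever of the two maps it is inserted into.
\<close>

locale exponential_family = gauge_space V N + finite_measure M
  for V :: "'v::real_vector set" and N and M :: "'x measure" +
  fixes l m :: "'v \<Rightarrow> 'x \<Rightarrow> real" and K :: real
  assumes l_measurable: "v \<in> V \<Longrightarrow> l v \<in> borel_measurable M"
    and m_measurable: "v \<in> V \<Longrightarrow> m v \<in> borel_measurable M"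
    and l_add: "v \<in> V \<Longrightarrow> w \<in> V \<Longrightarrow> l (v + w) x = l v x + l w x"
    and m_add: "v \<in> V \<Longrightarrow> w \<in> V \<Longrightarrow> m (v + w) x = m v x + m w x"
    and l_scale: "v \<in> V \<Longrightarrow> l (r *\<^sub>R v) x = r * l v x"
    and m_scale: "v \<in> V \<Longrightarrow> m (r *\<^sub>R v) x = r * m v x"
    and K_nonneg: "0 \<le> K"
    and l_bound: "v \<in> V \<Longrightarrow> x \<in> space M \<Longrightarrow> \<bar>l v x\<bar> \<le> K * N v"
    and m_bound: "v \<in> V \<Longrightarrow> x \<in> space M \<Longrightarrow> \<bar>m v x\<bar> \<le> K * N v"
begin

definition integrand :: "real \<Rightarrow> 'v \<Rightarrow> 'v list \<Rightarrow> 'x \<Rightarrow> real"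
  where "integrand c v vs x =
    exp (l v x) * exp_coeff (c + m v x) (map (\<lambda>w. (l w x, m w x)) vs)"

definition exp_derivative :: "real \<Rightarrow> nat \<Rightarrow> 'v \<Rightarrow> 'v list \<Rightarrow> real"
  where "exp_derivative c i v vs =
    (if length vs = i \<and> set vs \<subseteq> V then \<integral>x. integrand c v vs x \<partial>M else 0)"

lemma coeff_bounds:
  assumes v: "v \<in> V" and vs: "set vs \<subseteq> V" and x: "x \<in> space M"
  shows "\<bar>\<Prod>w\<leftarrow>vs. l w x\<bar> \<le> K ^ length vs * (\<Prod>w\<leftarrow>vs. N w)"
    and "\<bar>exp_coeff (c + m v x) (map (\<lambda>w. (l w x, m w x)) vs)\<bar>
      \<le> (\<bar>c\<bar> + K * N v + length vs) * (K ^ length vs * (\<Prod>w\<leftarrow>vs. N w))"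
proof -
  have K: "(\<Prod>w\<leftarrow>vs. K * N w) = K ^ length vs * (\<Prod>w\<leftarrow>vs. N w)"
    by (induction vs) simp_all
  have b: "\<bar>l w x\<bar> \<le> K * N w" "\<bar>m w x\<bar> \<le> K * N w" if "w \<in> set vs" for w
    using l_bound m_bound that vs x by auto
  show "\<bar>\<Prod>w\<leftarrow>vs. l w x\<bar> \<le> K ^ length vs * (\<Prod>w\<leftarrow>vs. N w)"
    unfolding K[symmetric] using b by (intro abs_prod_list_le)
  have "\<bar>exp_coeff (c + m v x) (map (\<lambda>w. (l w x, m w x)) vs)\<bar>
      \<le> (\<bar>c + m v x\<bar> + length vs) * (\<Prod>w\<leftarrow>vs. K * N w)"
    using b by (intro abs_exp_coeff_le)
  also have "\<dots> \<le> (\<bar>c\<bar> + K * N v + length vs) * (\<Prod>w\<leftarrow>vs. K * N w)"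
  proof (rule mult_right_mono)
    show "\<bar>c + m v x\<bar> + length vs \<le> \<bar>c\<bar> + K * N v + length vs"
      using m_bound[OF v x] by linarith
    show "0 \<le> (\<Prod>w\<leftarrow>vs. K * N w)"
      unfolding K using vs K_nonneg by (intro mult_nonneg_nonneg prod_N_nonneg) auto
  qed
  finally show "\<bar>exp_coeff (c + m v x) (map (\<lambda>w. (l w x, m w x)) vs)\<bar>
      \<le> (\<bar>c\<bar> + K * N v + length vs) * (K ^ length vs * (\<Prod>w\<leftarrow>vs. N w))"
    unfolding K .
qed

lemma abs_integrand_le:
  assumes "v \<in> V" "set vs \<subseteq> V" "x \<in> space M"
  shows "\<bar>integrand c v vs x\<bar> \<le>
    exp (K * N v) * (\<bar>c\<bar> + K * N v + length vs) * K ^ length vs * (\<Prod>w\<leftarrow>vs. N w)"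
proof -
  have "\<bar>integrand c v vs x\<bar> =
      exp (l v x) * \<bar>exp_coeff (c + m v x) (map (\<lambda>w. (l w x, m w x)) vs)\<bar>"
    by (simp add: integrand_def abs_mult)
  also have "\<dots> \<le> exp (K * N v) *
      ((\<bar>c\<bar> + K * N v + length vs) * (K ^ length vs * (\<Prod>w\<leftarrow>vs. N w)))"
    using l_bound[OF assms(1,3)] by (intro mult_mono coeff_bounds assms) auto
  finally show ?thesis by (simp add: mult.assoc)
qed

lemma integrand_measurable:
  assumes v: "v \<in> V" and vs: "set vs \<subseteq> V"
  shows "integrand c v vs \<in> borel_measurable M"
proof -
  have *: "(\<lambda>x. \<Prod>w\<leftarrow>vs. l w x) \<in> borel_measurable M" if "set vs \<subseteq> V" for vs
    using that by (induction vs) (auto intro!: borel_measurable_times l_measurable)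
  have "(\<lambda>x. exp_coeff (c + m v x) (map (\<lambda>w. (l w x, m w x)) vs)) \<in> borel_measurable M"
    using vs
  proof (induction vs)
    case Nil
    then show ?case using m_measurable[OF v] by simp
  next
    case (Cons w ws)
    then have [measurable]:
      "(\<lambda>x. exp_coeff (c + m v x) (map (\<lambda>w. (l w x, m w x)) ws)) \<in> borel_measurable M"
      "(\<lambda>x. \<Prod>w\<leftarrow>ws. l w x) \<in> borel_measurable M"
      "l w \<in> borel_measurable M" "m w \<in> borel_measurable M"
      by (auto intro: * l_measurable m_measurable)
    show ?case by (simp add: comp_def)
  qed
  moreover have [measurable]: "l v \<in> borel_measurable M" by (rule l_measurable[OF v])
  ultimately show ?thesis unfolding integrand_def[abs_def] by measurable
qed

lemma integrand_integrable:
  assumes "v \<in> V" "set vs \<subseteq> V"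
  shows "integrable M (integrand c v vs)"
  by (rule integrable_const_bound[OF AE_I2 integrand_measurable[OF assms]])
    (use abs_integrand_le[OF assms] in simp)

lemma abs_integral_le:
  assumes "f \<in> borel_measurable M" "\<And>x. x \<in> space M \<Longrightarrow> \<bar>f x\<bar> \<le> C"
  shows "\<bar>\<integral>x. f x \<partial>M\<bar> \<le> measure M (space M) * C"
proof -
  have i: "integrable M f"
    by (rule integrable_const_bound[OF AE_I2 assms(1)]) (use assms(2) in simp)
  have "\<bar>\<integral>x. f x \<partial>M\<bar> \<le> (\<integral>x. \<bar>f x\<bar> \<partial>M)"
    using integral_norm_bound[of M f] by simp
  also have "\<dots> \<le> (\<integral>x. C \<partial>M)"
    using i assms(2) by (intro integral_mono) auto
  finally show ?thesis by simp
qed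

lemma exp_derivative_forms:
  assumes v: "v \<in> V"
  shows "exp_derivative c i v \<in> forms i"
proof (rule formsI[where C =
      "measure M (space M) * (exp (K * N v) * (\<bar>c\<bar> + K * N v + i) * K ^ i)"], goal_cases)
  case (1 vs)
  then show ?case by (auto simp: exp_derivative_def)
next
  case (2 vs j w w')
  have sub: "set (vs[j := u]) \<subseteq> V" if "u \<in> V" for u
    using set_update_subset_insert[of vs j u] that 2 by blast
  have "integrand c v (vs[j := w + w']) x = integrand c v (vs[j := w]) x + integrand c v (vs[j := w']) x"
    for x
    using 2 by (simp add: integrand_def map_update l_add m_add exp_coeff_update_add algebra_simps)
  then have "(\<integral>x. integrand c v (vs[j := w + w']) x \<partial>M) =
      (\<integral>x. integrand c v (vs[j := w]) x \<partial>M) + (\<integral>x. integrand c v (vs[j := w']) x \<partial>M)"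
    using integrand_integrable[OF v sub] 2 by simp
  then show ?case using 2 sub by (simp add: exp_derivative_def add_V)
next
  case (3 vs j r w)
  have sub: "set (vs[j := u]) \<subseteq> V" if "u \<in> V" for u
    using set_update_subset_insert[of vs j u] that 3 by blast
  have "integrand c v (vs[j := r *\<^sub>R w]) x = r * integrand c v (vs[j := w]) x" for x
    using 3 by (simp add: integrand_def map_update l_scale m_scale exp_coeff_update_scale algebra_simps)
  then have "(\<integral>x. integrand c v (vs[j := r *\<^sub>R w]) x \<partial>M) = r * (\<integral>x. integrand c v (vs[j := w]) x \<partial>M)"
    by simp
  then show ?case using 3 sub by (simp add: exp_derivative_def scale_V)
next
  case (4 vs)
  then show ?case
    using abs_integral_le[OF integrand_measurable[OF v 4(2)] abs_integrand_le[OF v 4(2)]]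
    by (simp add: exp_derivative_def mult.assoc)
qed

lemma integrand_remainder:
  assumes v: "v \<in> V" and h: "h \<in> V" "N h \<le> 1" and vs: "set vs \<subseteq> V" and x: "x \<in> space M"
  shows "\<bar>integrand c (v + h) vs x - integrand c v vs x - integrand c v (h # vs) x\<bar> \<le>
    exp (K * N v + K) * (K * N h)\<^sup>2 *
      ((\<bar>c\<bar> + K * N v + length vs + 1) * (K ^ length vs * (\<Prod>w\<leftarrow>vs. N w)))"
proof -
  let ?ps = "map (\<lambda>w. (l w x, m w x)) vs" and ?B = "K ^ length vs * (\<Prod>w\<leftarrow>vs. N w)"
  let ?D = "(\<bar>c\<bar> + K * N v + length vs) * ?B + ?B"
  have "0 \<le> ?B" using K_nonneg vs prod_N_nonneg by simp
  then have D: "0 \<le> ?D" using K_nonneg N_nonneg[OF v] by simp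
  have "\<bar>exp (l v x + l h x) * exp_coeff (c + m v x + m h x) ?ps
      - exp (l v x) * exp_coeff (c + m v x) ?ps
      - exp (l v x) * exp_coeff (c + m v x) ((l h x, m h x) # ?ps)\<bar>
      \<le> exp (\<bar>l v x\<bar> + K * N h) * (K * N h)\<^sup>2 * ?D"
    using coeff_bounds[OF v vs x]
    by (intro exp_coeff_remainder l_bound m_bound h x) (simp_all add: comp_def)
  also have "\<dots> \<le> exp (K * N v + K) * (K * N h)\<^sup>2 * ?D"
    using l_bound[OF v x] h K_nonneg mult_left_mono[OF h(2) K_nonneg]
    by (intro mult_right_mono D) auto
  finally show ?thesis
    using v h by (simp add: integrand_def l_add m_add algebra_simps)
qed

text \<open>
  The pointwise remainder is \<open>O((N h)\<^sup>2)\<close> with a constant that does not depend on the point of the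
  measure space, so it can be integrated.
\<close>

lemma exp_derivative_has_derivative:
  assumes v: "v \<in> V"
  shows "has_form_derivative V N V i (exp_derivative c i) (exp_derivative c (Suc i) v) v"
  unfolding has_form_derivative_def
proof (intro conjI allI impI exp_derivative_forms v)
  fix \<epsilon> :: real assume \<epsilon>: "\<epsilon> > 0"
  define C where "C = measure M (space M) *
    (exp (K * N v + K) * K\<^sup>2 * ((\<bar>c\<bar> + K * N v + i + 1) * K ^ i))"
  have C: "C \<ge> 0"
    unfolding C_def using K_nonneg N_nonneg[OF v]
    by (intro mult_nonneg_nonneg add_nonneg_nonneg) auto
  show "\<exists>\<delta>>0. \<forall>h\<in>V. v + h \<in> V \<and> N h < \<delta> \<longrightarrow> form_norm V N i (\<lambda>vs.
      exp_derivative c i (v + h) vs - exp_derivative c i v vs -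
      exp_derivative c (Suc i) v (h # vs)) \<le> \<epsilon> * N h"
  proof (intro exI[of _ "min 1 (\<epsilon> / (1 + C))"] conjI ballI impI)
    show "min 1 (\<epsilon> / (1 + C)) > 0" using \<epsilon> C by simp
    fix h assume h: "h \<in> V" "v + h \<in> V \<and> N h < min 1 (\<epsilon> / (1 + C))"
    have Nh: "0 \<le> N h" "N h \<le> 1" using N_nonneg h by auto
    have "form_norm V N i (\<lambda>vs. exp_derivative c i (v + h) vs - exp_derivative c i v vs -
      exp_derivative c (Suc i) v (h # vs)) \<le> C * (N h)\<^sup>2"
    proof (rule form_norm_le_bound)
      show "0 \<le> C * (N h)\<^sup>2" using C by simp
      fix vs assume vs: "length vs = i" "set vs \<subseteq> V"
      let ?R = "\<lambda>x. integrand c (v + h) vs x - integrand c v vs x - integrand c v (h # vs) x"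
      have hvs: "set (h # vs) \<subseteq> V" and vh: "v + h \<in> V" using h vs by auto
      note int [simp] = integrand_integrable[OF v vs(2)] integrand_integrable[OF vh vs(2)]
        integrand_integrable[OF v hvs]
      have "exp_derivative c i (v + h) vs - exp_derivative c i v vs -
          exp_derivative c (Suc i) v (h # vs) = (\<integral>x. ?R x \<partial>M)"
        using vs hvs by (simp add: exp_derivative_def)
      also have "\<bar>\<dots>\<bar> \<le> measure M (space M) * (exp (K * N v + K) * (K * N h)\<^sup>2 *
          ((\<bar>c\<bar> + K * N v + length vs + 1) * (K ^ length vs * (\<Prod>w\<leftarrow>vs. N w))))"
        using integrand_measurable[OF v vs(2)] integrand_measurable[OF vh vs(2)]
          integrand_measurable[OF v hvs]
        by (intro abs_integral_le integrand_remainder v h vs Nh borel_measurable_diff)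
      also have "\<dots> = C * (N h)\<^sup>2 * (\<Prod>w\<leftarrow>vs. N w)"
        unfolding C_def vs(1) power_mult_distrib by (simp only: ac_simps)
      finally show "\<bar>exp_derivative c i (v + h) vs - exp_derivative c i v vs -
          exp_derivative c (Suc i) v (h # vs)\<bar> \<le> C * (N h)\<^sup>2 * (\<Prod>w\<leftarrow>vs. N w)" .
    qed
    also have "C * (N h)\<^sup>2 = (C * N h) * N h" by (simp add: power2_eq_square)
    also have "\<dots> \<le> \<epsilon> * N h"
    proof (rule mult_right_mono[OF _ Nh(1)])
      have "C * N h \<le> (1 + C) * N h" using Nh by (simp add: algebra_simps)
      also have "\<dots> \<le> \<epsilon>" using h C by (simp add: field_simps)
      finally show "C * N h \<le> \<epsilon>" .
    qed
    finally show "form_norm V N i (\<lambda>vs. exp_derivative c i (v + h) vs -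
      exp_derivative c i v vs - exp_derivative c (Suc i) v (h # vs)) \<le> \<epsilon> * N h" .
  qed
qed

theorem C_infinity_exp_integral:
  "C_infinity_on V N V (\<lambda>v. \<integral>x. exp (l v x) * (c + m v x) \<partial>M)"
proof (rule C_infinity_onI[OF gauge_open_V order_refl])
  show "derivative_tower k V (\<lambda>v. \<integral>x. exp (l v x) * (c + m v x) \<partial>M) (exp_derivative c)" for k
    unfolding derivative_tower_def
    by (auto simp: exp_derivative_def integrand_def[abs_def] fun_eq_iff
        intro: exp_derivative_has_derivative)
qed

end

section \<open>The model space\<close>

interpretation norm_space: gauge_space "UNIV :: 'x::real_normed_vector set" norm
  by standard simp_all

lemma norm_space_open:
  assumes "open B"
  shows "norm_space.gauge_open B"
  unfolding norm_space.gauge_open_def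
proof
  fix x assume "x \<in> B"
  then obtain r where "r > 0" "ball x r \<subseteq> B" using assms open_contains_ball by blast
  then show "\<exists>r>0. \<forall>h\<in>UNIV. norm h < r \<longrightarrow> x + h \<in> B"
    by (intro exI[of _ r]) (auto simp: subset_iff dist_norm)
qed

text \<open>
  A supremum in \<open>form_norm\<close> is meaningful only for bounded forms; the derivatives up to order \<open>k\<close> of
  a function in \<open>C\<^sub>b\<^sup>k\<close> are bounded forms because they exist.
\<close>

lemma Cb_form_norm_nonneg:
  assumes "a \<in> Cb k B" "i \<le> k" "x \<in> B"
  shows "0 \<le> form_norm UNIV norm i (nth_derivative UNIV norm B a i x)"
  using assms
  by (intro norm_space.form_norm_nonneg norm_space.tower_forms[OF norm_space.C_k_on_tower])
    (auto simp: Cb_def)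

lemma Cb_form_norm_lincomb:
  assumes B: "open B" and a: "a \<in> Cb k B" and b: "b \<in> Cb k B" and i: "i \<le> k" and x: "x \<in> B"
  shows "form_norm UNIV norm i (nth_derivative UNIV norm B (\<lambda>x. c * a x + d * b x) i x)
    \<le> \<bar>c\<bar> * form_norm UNIV norm i (nth_derivative UNIV norm B a i x)
      + \<bar>d\<bar> * form_norm UNIV norm i (nth_derivative UNIV norm B b i x)"
proof -
  have "C_k_on UNIV norm k B a" "C_k_on UNIV norm k B b"
    using a b by (auto simp: Cb_def)
  note 1 = norm_space.nth_derivative_lincomb[OF norm_space_open[OF B] this i x, of c d]
    and 2 = this[THEN norm_space.C_k_on_tower]
  show ?thesis
    unfolding 1 by (intro norm_space.form_norm_lincomb norm_space.tower_forms[OF _ i x, OF 2(1)]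
      norm_space.tower_forms[OF _ i x, OF 2(2)])
qed

lemma bounded_image_iff_abs_le:
  fixes f :: "'a \<Rightarrow> real"
  shows "bounded (f ` A) \<longleftrightarrow> (\<exists>C. \<forall>x\<in>A. \<bar>f x\<bar> \<le> C)"
  by (simp add: bounded_iff)

lemma bounded_image_lincomb:
  fixes f g h :: "'a \<Rightarrow> real"
  assumes "bounded (f ` A)" "bounded (g ` A)"
    and h: "\<And>x. x \<in> A \<Longrightarrow> \<bar>h x\<bar> \<le> \<bar>c\<bar> * \<bar>f x\<bar> + \<bar>d\<bar> * \<bar>g x\<bar>"
  shows "bounded (h ` A)"
proof -
  obtain C D where C: "\<And>x. x \<in> A \<Longrightarrow> \<bar>f x\<bar> \<le> C" and D: "\<And>x. x \<in> A \<Longrightarrow> \<bar>g x\<bar> \<le> D"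
    using assms unfolding bounded_image_iff_abs_le by blast
  have "\<bar>h x\<bar> \<le> \<bar>c\<bar> * C + \<bar>d\<bar> * D" if "x \<in> A" for x
    by (rule order_trans[OF h[OF that]]) (intro add_mono mult_left_mono C D that abs_ge_zero)
  then show ?thesis unfolding bounded_image_iff_abs_le by blast
qed

lemma Cb_lincomb:
  assumes B: "open B" and a: "a \<in> Cb k B" and b: "b \<in> Cb k B"
  shows "(\<lambda>x. c * a x + d * b x) \<in> Cb k B"
  unfolding Cb_def
proof (intro CollectI conjI allI impI ballI)
  show "C_k_on UNIV norm k B (\<lambda>x. c * a x + d * b x)"
    using a b by (intro norm_space.C_k_on_lincomb norm_space_open B) (auto simp: Cb_def)
  show "bounded ((\<lambda>x. c * a x + d * b x) ` B)"
  proof (rule bounded_image_lincomb)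
    show "bounded (a ` B)" "bounded (b ` B)" using a b by (auto simp: Cb_def)
    show "\<bar>c * a x + d * b x\<bar> \<le> \<bar>c\<bar> * \<bar>a x\<bar> + \<bar>d\<bar> * \<bar>b x\<bar>" for x
      unfolding abs_mult[symmetric] by (rule abs_triangle_ineq)
  qed
next
  let ?f = "\<lambda>a i x. form_norm UNIV norm i (nth_derivative UNIV norm B a i x)"
  fix i assume i: "i \<in> {1..k}"
  show "bounded (?f (\<lambda>x. c * a x + d * b x) i ` B)"
  proof (rule bounded_image_lincomb)
    show "bounded (?f a i ` B)" "bounded (?f b i ` B)" using a b i by (auto simp: Cb_def)
    fix x assume x: "x \<in> B"
    have i': "i \<le> k" using i by simp
    have ab: "(\<lambda>x. c * a x + d * b x) \<in> {a. C_k_on UNIV norm k B a}"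
      using a b by (auto simp: Cb_def intro!: norm_space.C_k_on_lincomb norm_space_open B)
    have "0 \<le> ?f (\<lambda>x. c * a x + d * b x) i x"
      using ab by (intro norm_space.form_norm_nonneg
        norm_space.tower_forms[OF norm_space.C_k_on_tower i' x]) simp
    then show "\<bar>?f (\<lambda>x. c * a x + d * b x) i x\<bar> \<le> \<bar>c\<bar> * \<bar>?f a i x\<bar> + \<bar>d\<bar> * \<bar>?f b i x\<bar>"
      using Cb_form_norm_lincomb[OF B a b i' x, of c d]
        Cb_form_norm_nonneg[OF a i' x] Cb_form_norm_nonneg[OF b i' x] by simp
  qed
qed (use a b in \<open>auto simp: Cb_def\<close>)

lemma zero_in_Cb:
  assumes B: "open B"
  shows "(\<lambda>x. 0) \<in> Cb k B"
proof -
  have *: "norm_space.gauge_open B" by (rule norm_space_open[OF B])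
  have "C_infinity_on UNIV norm B (\<lambda>x. 0)"
    by (rule norm_space.C_infinity_onI[OF * subset_UNIV norm_space.tower_zero])
  moreover have "nth_derivative UNIV norm B (\<lambda>x. 0) i x = (\<lambda>vs. 0)" if "x \<in> B" for i x
    by (rule norm_space.nth_derivative_eq_tower[OF * norm_space.tower_zero order_refl that])
  ultimately show ?thesis
    by (auto simp: Cb_def C_infinity_on_def bounded_image_iff_abs_le)
qed

lemma SUP_scale_le:
  fixes f g :: "'a \<Rightarrow> real"
  assumes "A \<noteq> {}" "bounded (f ` A)" "\<And>x. x \<in> A \<Longrightarrow> g x \<le> \<bar>c\<bar> * f x"
  shows "(SUP x\<in>A. g x) \<le> \<bar>c\<bar> * (SUP x\<in>A. f x)"
proof (rule cSUP_least[OF assms(1)])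
  fix x assume x: "x \<in> A"
  have "f x \<le> (SUP x\<in>A. f x)"
    by (rule cSUP_upper[OF x bounded_imp_bdd_above[OF assms(2)]])
  then show "g x \<le> \<bar>c\<bar> * (SUP x\<in>A. f x)"
    using assms(3)[OF x] mult_left_mono[OF _ abs_ge_zero[of c]] by (meson order_trans)
qed

lemma bounded_abs_image:
  fixes f :: "'a \<Rightarrow> real"
  shows "bounded (f ` A) \<Longrightarrow> bounded ((\<lambda>x. \<bar>f x\<bar>) ` A)"
  unfolding bounded_image_iff_abs_le by simp

text \<open>
  Evaluations are functionals of norm at most 1, uniformly in the point; from this the constant of
  the \<open>exponential_family\<close> on \<open>C\<^sub>b\<^sup>k \<times> C\<^sub>b\<^sup>k\<close> is obtained.
\<close>

lemma abs_le_Cb_norm: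
  assumes a: "a \<in> Cb k B" and x: "x \<in> B"
  shows "\<bar>a x\<bar> \<le> Cb_norm k B a"
proof -
  let ?f = "\<lambda>i x. form_norm UNIV norm i (nth_derivative UNIV norm B a i x)"
  have "bounded (a ` B)" using a by (simp add: Cb_def)
  then have "\<bar>a x\<bar> \<le> (SUP x\<in>B. \<bar>a x\<bar>)"
    by (intro cSUP_upper x bounded_imp_bdd_above bounded_abs_image)
  moreover have "0 \<le> (\<Sum>i=1..k. SUP x\<in>B. ?f i x)"
  proof (rule sum_nonneg)
    fix i assume i: "i \<in> {1..k}"
    then have "bounded (?f i ` B)" using a by (simp add: Cb_def)
    then have "?f i x \<le> (SUP x\<in>B. ?f i x)"
      by (intro cSUP_upper x bounded_imp_bdd_above)
    moreover have "0 \<le> ?f i x" using i by (intro Cb_form_norm_nonneg[OF a _ x]) simp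
    ultimately show "0 \<le> (SUP x\<in>B. ?f i x)" by simp
  qed
  ultimately show ?thesis by (simp add: Cb_norm_def)
qed

lemma Cb_norm_scale:
  assumes B: "open B" "B \<noteq> {}" and a: "a \<in> Cb k B"
  shows "Cb_norm k B (\<lambda>x. c * a x) \<le> \<bar>c\<bar> * Cb_norm k B a"
proof -
  let ?f = "\<lambda>a i x. form_norm UNIV norm i (nth_derivative UNIV norm B a i x)"
  have "(SUP x\<in>B. \<bar>c * a x\<bar>) \<le> \<bar>c\<bar> * (SUP x\<in>B. \<bar>a x\<bar>)"
    using a by (intro SUP_scale_le B bounded_abs_image) (auto simp: Cb_def abs_mult)
  moreover have "(\<Sum>i=1..k. SUP x\<in>B. ?f (\<lambda>x. c * a x) i x)
      \<le> (\<Sum>i=1..k. \<bar>c\<bar> * (SUP x\<in>B. ?f a i x))"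
  proof (rule sum_mono, rule SUP_scale_le[OF B(2)])
    fix i assume i: "i \<in> {1..k}"
    show "bounded (?f a i ` B)" using a i by (simp add: Cb_def)
    show "?f (\<lambda>x. c * a x) i x \<le> \<bar>c\<bar> * ?f a i x" if "x \<in> B" for x
      using Cb_form_norm_lincomb[OF B(1) a a _ that, of i c 0] i by simp
  qed
  ultimately show ?thesis by (simp add: Cb_norm_def distrib_left sum_distrib_left)
qed

lemma Cb_gauge_space:
  assumes "open B" "B \<noteq> {}"
  shows "gauge_space (Cb k B) (Cb_norm k B)"
proof
  show "subspace (Cb k B)"
    unfolding subspace_def
  proof (intro conjI ballI allI)
    show "0 \<in> Cb k B" using zero_in_Cb[OF assms(1)] by (simp add: zero_fun_def)
    fix a assume a: "a \<in> Cb k B"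
    show "c *\<^sub>R a \<in> Cb k B" for c
      using Cb_lincomb[OF assms(1) a a, of c 0] by (simp add: scaleR_fun_def)
    show "a + b \<in> Cb k B" if "b \<in> Cb k B" for b
      using Cb_lincomb[OF assms(1) a that, of 1 1] by (simp add: plus_fun_def)
  qed
  fix a assume a: "a \<in> Cb k B"
  show "0 \<le> Cb_norm k B a"
    using abs_le_Cb_norm[OF a] assms(2) by (meson abs_ge_zero all_not_in_conv order_trans)
  show "Cb_norm k B (c *\<^sub>R a) \<le> \<bar>c\<bar> * Cb_norm k B a" for c
    using Cb_norm_scale[OF assms a] by (simp add: scaleR_fun_def)
qed

lemma gauge_space_Times:
  assumes "gauge_space V N" "gauge_space W N'"
  shows "gauge_space (V \<times> W) (prod_norm N N')"
proof -
  interpret V: gauge_space V N by (rule assms)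
  interpret W: gauge_space W N' by (rule assms)
  show ?thesis
  proof
    show "subspace (V \<times> W)" by (rule subspace_Times[OF V.subspace_V W.subspace_V])
    fix v assume "v \<in> V \<times> W"
    then obtain a b where v: "v = (a, b)" "a \<in> V" "b \<in> W" by auto
    show "0 \<le> prod_norm N N' v"
      using V.N_nonneg[of a] v by (simp add: prod_norm_def le_max_iff_disj)
    fix c
    have "N (c *\<^sub>R a) \<le> \<bar>c\<bar> * max (N a) (N' b)" "N' (c *\<^sub>R b) \<le> \<bar>c\<bar> * max (N a) (N' b)"
      using v by (auto intro!: order_trans[OF V.N_scale] order_trans[OF W.N_scale] mult_left_mono)
    then show "prod_norm N N' (c *\<^sub>R v) \<le> \<bar>c\<bar> * prod_norm N N' v"
      by (simp add: prod_norm_def v)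
  qed
qed

lemma Cb_measurable:
  assumes "a \<in> Cb k B" "sets \<mu> = sets (restrict_space borel B)"
  shows "a \<in> borel_measurable \<mu>"
  using borel_measurable_continuous_on_restrict[OF Cb_continuous_on[OF assms(1)]]
    measurable_cong_sets[OF assms(2) refl] by blast

lemma exponential_family_Cb:
  fixes B :: "'x::real_normed_vector set"
  assumes B: "open B" and mu: "prob_space \<mu>" "sets \<mu> = sets (restrict_space borel B)"
  shows "exponential_family (Cb k B \<times> Cb k B) (prod_norm (Cb_norm k B) (Cb_norm k B)) \<mu>
    (\<lambda>(a, b) x. s * a x + t * b x) (\<lambda>(a, b) x. p * a x + r * b x)
    (\<bar>s\<bar> + \<bar>t\<bar> + \<bar>p\<bar> + \<bar>r\<bar>)"
proof -
  interpret prob_space \<mu> by (rule mu)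
  have sp: "space \<mu> = B" using sets_eq_imp_space_eq[OF mu(2)] by (simp add: space_restrict_space)
  interpret Cb: gauge_space "Cb k B" "Cb_norm k B"
    by (rule Cb_gauge_space[OF B]) (use not_empty sp in blast)
  interpret CC: gauge_space "Cb k B \<times> Cb k B" "prod_norm (Cb_norm k B) (Cb_norm k B)"
    by (rule gauge_space_Times) unfold_locales
  let ?N = "prod_norm (Cb_norm k B) (Cb_norm k B)" and ?K = "\<bar>s\<bar> + \<bar>t\<bar> + \<bar>p\<bar> + \<bar>r\<bar>"
  have bound: "\<bar>c * a x + d * b x\<bar> \<le> ?K * ?N (a, b)"
    if "a \<in> Cb k B" "b \<in> Cb k B" "x \<in> B" "\<bar>c\<bar> + \<bar>d\<bar> \<le> ?K" for a b x c d
  proof -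
    have "\<bar>a x\<bar> \<le> ?N (a, b)" "\<bar>b x\<bar> \<le> ?N (a, b)"
      using abs_le_Cb_norm[OF that(1,3)] abs_le_Cb_norm[OF that(2,3)]
      by (auto simp: prod_norm_def)
    then have "\<bar>c\<bar> * \<bar>a x\<bar> + \<bar>d\<bar> * \<bar>b x\<bar> \<le> \<bar>c\<bar> * ?N (a, b) + \<bar>d\<bar> * ?N (a, b)"
      by (intro add_mono mult_left_mono) auto
    also have "\<dots> \<le> ?K * ?N (a, b)"
      unfolding distrib_right[symmetric]
      by (rule mult_right_mono[OF that(4)]) (use that CC.N_nonneg in auto)
    finally show ?thesis
      using abs_triangle_ineq[of "c * a x" "d * b x"] by (simp add: abs_mult)
  qed
  have meas: "(\<lambda>x. c * a x + d * b x) \<in> borel_measurable \<mu>"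
    if "a \<in> Cb k B" "b \<in> Cb k B" for a b c d
    using Cb_measurable[OF that(1) mu(2)] Cb_measurable[OF that(2) mu(2)] by measurable
  show ?thesis
proof (unfold_locales, goal_cases)
    case (8 v x)
    then show ?case using bound[of "fst v" "snd v" x s t] by (cases v) (simp add: sp)
  next
    case (9 v x)
    then show ?case using bound[of "fst v" "snd v" x p r] by (cases v) (simp add: sp)
  qed (auto simp: plus_fun_def scaleR_fun_def distrib_left intro: meas)
qed

section \<open>The divergences in the chart\<close>

lemma inv_into_map_prod:
  assumes "inj_on f A" "inj_on g B" "x \<in> A" "y \<in> B"
  shows "inv_into (A \<times> B) (map_prod f g) (f x, g y) = (x, y)"
  by (rule inv_into_f_eq[OF map_prod_inj_on[OF assms(1,2)]]) (use assms in auto)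

text \<open>
  Expanding the product \<open>\<phi>\<^sub>\<alpha>(P) \<phi>\<^sub>-\<^sub>\<alpha>(Q)\<close> produces integrals of \<open>exp (\<beta> a)\<close> and \<open>exp (\<gamma> b)\<close>, which
  cancel those of the other two terms; what remains of the constants is a multiple of
  \<open>1 - (\<beta> + \<gamma>) = 0\<close>.
\<close>

lemma divergence_chart:
  assumes mu: "prob_space \<mu>" and \<alpha>: "\<alpha> \<noteq> 1" "\<alpha> \<noteq> -1"
    and PQ: "phi_1 k B \<mu> P = a" "phi_1 k B \<mu> Q = b"
    and int: "\<And>s t. integrable \<mu> (\<lambda>x. exp (s * a x + t * b x))"
  defines "\<beta> \<equiv> (1 - \<alpha>) / 2" and "\<gamma> \<equiv> (1 + \<alpha>) / 2"
  shows "divergence k B \<mu> \<alpha> P Q =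
    1 / \<gamma> * (\<integral>x. exp (a x) \<partial>\<mu>) + 1 / \<beta> * (\<integral>x. exp (b x) \<partial>\<mu>)
      - 1 / (\<beta> * \<gamma>) * (\<integral>x. exp (\<beta> * a x + \<gamma> * b x) \<partial>\<mu>)"
proof -
  interpret prob_space \<mu> by (rule mu)
  have nz: "\<beta> \<noteq> 0" "\<gamma> \<noteq> 0" and sum: "\<beta> + \<gamma> = 1"
    using \<alpha> by (auto simp: \<beta>_def \<gamma>_def field_simps)
  have \<alpha>': "2 / (1 + \<alpha>) = 1 / \<gamma>" "2 / (1 - \<alpha>) = 1 / \<beta>" by (simp_all add: \<beta>_def \<gamma>_def)
  have [simp]: "integrable \<mu> (\<lambda>x. exp (s * a x))" "integrable \<mu> (\<lambda>x. exp (s * b x))"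
    "integrable \<mu> (\<lambda>x. exp (a x))" "integrable \<mu> (\<lambda>x. exp (b x))" for s
    using int[of s 0] int[of 0 s] int[of 1 0] int[of 0 1] by simp_all
  note [simp] = int[of \<beta> \<gamma>]
  let ?A = "\<integral>x. exp (a x) \<partial>\<mu>" and ?B = "\<integral>x. exp (b x) \<partial>\<mu>"
    and ?A' = "\<integral>x. exp (\<beta> * a x) \<partial>\<mu>" and ?B' = "\<integral>x. exp (\<gamma> * b x) \<partial>\<mu>"
    and ?C = "\<integral>x. exp (\<beta> * a x + \<gamma> * b x) \<partial>\<mu>"
  have phi: "phi k B \<mu> (-1) P x = exp (a x) - 1" "phi k B \<mu> (-1) Q x = exp (b x) - 1"
    "phi k B \<mu> \<alpha> P x = 1 / \<beta> * (exp (\<beta> * a x) - 1)"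
    "phi k B \<mu> (-\<alpha>) Q x = 1 / \<gamma> * (exp (\<gamma> * b x) - 1)" for x
    using \<alpha> by (simp_all add: phi_def PQ \<alpha>'(1)) (simp_all add: \<beta>_def \<gamma>_def)
  have 1: "(\<integral>x. (phi k B \<mu> (-1) P x - phi k B \<mu> \<alpha> P x) \<partial>\<mu>) = ?A - 1 - 1 / \<beta> * (?A' - 1)"
    unfolding phi by (simp add: prob_space)
  have 2: "(\<integral>x. (phi k B \<mu> (-1) Q x - phi k B \<mu> (-\<alpha>) Q x) \<partial>\<mu>) = ?B - 1 - 1 / \<gamma> * (?B' - 1)"
    unfolding phi by (simp add: prob_space)
  have "phi k B \<mu> \<alpha> P x * phi k B \<mu> (-\<alpha>) Q x =
      1 / (\<beta> * \<gamma>) * (exp (\<beta> * a x + \<gamma> * b x) - exp (\<beta> * a x) - exp (\<gamma> * b x) + 1)" for x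
    unfolding phi by (simp add: exp_add algebra_simps)
  then have 3: "(\<integral>x. phi k B \<mu> \<alpha> P x * phi k B \<mu> (-\<alpha>) Q x \<partial>\<mu>) =
      1 / (\<beta> * \<gamma>) * (?C - ?A' - ?B' + 1)"
    by (simp add: prob_space)
  have "1 / \<gamma> * (?A - 1 - 1 / \<beta> * (?A' - 1)) + 1 / \<beta> * (?B - 1 - 1 / \<gamma> * (?B' - 1))
      - 1 / (\<beta> * \<gamma>) * (?C - ?A' - ?B' + 1) =
    1 / \<gamma> * ?A + 1 / \<beta> * ?B - 1 / (\<beta> * \<gamma>) * ?C + (1 - (\<beta> + \<gamma>)) / (\<beta> * \<gamma>)"
    using nz by (simp add: field_simps)
  then show ?thesis
    using \<alpha> sum unfolding divergence_def \<alpha>' 1 2 3 by simp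
qed

lemma divergence_m1_chart:
  assumes PQ: "phi_1 k B \<mu> P = a" "phi_1 k B \<mu> Q = b"
    and int: "integrable \<mu> (\<lambda>x. exp (a x))" "integrable \<mu> (\<lambda>x. exp (b x))"
      "integrable \<mu> (\<lambda>x. exp (a x) * (a x - b x))"
  shows "divergence_m1 k B \<mu> P Q =
    (\<integral>x. exp (b x) \<partial>\<mu>) + (\<integral>x. exp (a x) * (-1 + (a x - b x)) \<partial>\<mu>)"
proof -
  have phi: "phi k B \<mu> (-1) P x = exp (a x) - 1" "phi k B \<mu> (-1) Q x = exp (b x) - 1"
    "phi k B \<mu> 1 P x = a x" "phi k B \<mu> 1 Q x = b x" for x
    by (simp_all add: phi_def PQ)
  have "exp (a x) * (-1 + (a x - b x)) = exp (a x) * (a x - b x) - exp (a x)" for x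
    by (simp add: algebra_simps)
  then show ?thesis
    using int unfolding divergence_m1_def phi by simp
qed

text \<open>
  Composing with the inverse of the chart replaces \<open>(P, Q)\<close> by \<open>(a, b)\<close>. In each of the cases \<open>\<alpha> = -1\<close>,
  \<open>\<alpha> = 1\<close> (where \<open>P\<close> and \<open>Q\<close> are exchanged) and \<open>\<alpha> \<noteq> \<plusminus>1\<close>, the formulas above then give a linear
  combination of smooth integrals \<open>I s t c p r\<close>.
\<close>

theorem mainTheorem6:
  fixes B :: "'x::banach set" and \<mu> :: "'x measure" and k :: nat and \<alpha> :: real
  assumes "open B"
    and "prob_space \<mu>"
    and "sets \<mu> = sets (restrict_space borel B)"
    and "\<And>A. open A \<Longrightarrow> A \<subseteq> B \<Longrightarrow> A \<noteq> {} \<Longrightarrow> measure \<mu> A > 0"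
  shows "C_infinity_manifold (Cb k B \<times> Cb k B) (prod_norm (Cb_norm k B) (Cb_norm k B))
      (stat_manifold k B \<mu> \<times> stat_manifold k B \<mu>) (map_prod (phi_1 k B \<mu>) (phi_1 k B \<mu>))
      (\<lambda>(P, Q). divergence k B \<mu> \<alpha> P Q)"
proof -
  let ?V = "Cb k B \<times> Cb k B" and ?N = "prod_norm (Cb_norm k B) (Cb_norm k B)"
  let ?M = "stat_manifold k B \<mu>" and ?\<phi> = "phi_1 k B \<mu>"
  let ?F = "(\<lambda>(P, Q). divergence k B \<mu> \<alpha> P Q) \<circ> inv_into (?M \<times> ?M) (map_prod ?\<phi> ?\<phi>)"
  define I :: "real \<Rightarrow> real \<Rightarrow> real \<Rightarrow> real \<Rightarrow> real \<Rightarrow> ('x \<Rightarrow> real) \<times> ('x \<Rightarrow> real) \<Rightarrow> real"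
    where "I = (\<lambda>s t c p r (a, b). \<integral>x. exp (s * a x + t * b x) * (c + (p * a x + r * b x)) \<partial>\<mu>)"
  have ef: "exponential_family ?V ?N \<mu> (\<lambda>(a, b) x. s * a x + t * b x) (\<lambda>(a, b) x. p * a x + r * b x)
      (\<bar>s\<bar> + \<bar>t\<bar> + \<bar>p\<bar> + \<bar>r\<bar>)" for s t p r
    by (rule exponential_family_Cb[OF assms(1-3)])
  interpret E: gauge_space ?V ?N 
    using ef[of 0 0 0 0] by (rule exponential_family.axioms(1))
  have smooth: "C_infinity_on ?V ?N ?V (I s t c p r)" for s t c p r
  proof -
    interpret exponential_family ?V ?N \<mu> "\<lambda>(a, b) x. s * a x + t * b x"
      "\<lambda>(a, b) x. p * a x + r * b x" "\<bar>s\<bar> + \<bar>t\<bar> + \<bar>p\<bar> + \<bar>r\<bar>"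
      by (rule ef)
    have "I s t c p r = (\<lambda>v. \<integral>x. exp ((case v of (a, b) \<Rightarrow> \<lambda>x. s * a x + t * b x) x) *
        (c + (case v of (a, b) \<Rightarrow> \<lambda>x. p * a x + r * b x) x) \<partial>\<mu>)"
      by (auto simp: I_def)
    then show ?thesis using C_infinity_exp_integral[of c] by simp
  qed
  have int: "integrable \<mu> (\<lambda>x. exp (s * a x + t * b x) * (c + (p * a x + r * b x)))"
    if "a \<in> Cb k B" "b \<in> Cb k B" for a b s t c p r
  proof -
    interpret exponential_family ?V ?N \<mu> "\<lambda>(a, b) x. s * a x + t * b x"
      "\<lambda>(a, b) x. p * a x + r * b x" "\<bar>s\<bar> + \<bar>t\<bar> + \<bar>p\<bar> + \<bar>r\<bar>"
      by (rule ef)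
    show ?thesis
      using integrand_integrable[of "(a, b)" "[]" c] that by (simp add: integrand_def[abs_def])
  qed
  have bij: "bij_betw ?\<phi> ?M (Cb k B)" by (rule bij_betw_phi_1[OF assms])
  have F: "\<exists>P Q. ?F (a, b) = divergence k B \<mu> \<alpha> P Q \<and> ?\<phi> P = a \<and> ?\<phi> Q = b"
    if ab: "a \<in> Cb k B" "b \<in> Cb k B" for a b
  proof -
    have "a \<in> ?\<phi> ` ?M" "b \<in> ?\<phi> ` ?M"
      using ab bij_betw_imp_surj_on[OF bij] by simp_all
    then obtain P Q where PQ: "P \<in> ?M" "Q \<in> ?M" "?\<phi> P = a" "?\<phi> Q = b"
      by (elim imageE) metis
    have "inv_into (?M \<times> ?M) (map_prod ?\<phi> ?\<phi>) (?\<phi> P, ?\<phi> Q) = (P, Q)"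
      by (rule inv_into_map_prod[OF bij_betw_imp_inj_on[OF bij] bij_betw_imp_inj_on[OF bij] PQ(1,2)])
    then have "?F (a, b) = divergence k B \<mu> \<alpha> P Q" by (simp add: PQ(3,4))
    then show ?thesis using PQ(3,4) by blast
  qed
  have int1: "integrable \<mu> (\<lambda>x. exp (a x))" "integrable \<mu> (\<lambda>x. exp (b x))"
      "integrable \<mu> (\<lambda>x. exp (a x) * (a x - b x))"
      "integrable \<mu> (\<lambda>x. exp (s * a x + t * b x))"
    if "a \<in> Cb k B" "b \<in> Cb k B" for a b s t
    using int[OF that, of 1 0 1 0 0] int[OF that, of 0 1 1 0 0] int[OF that, of 1 0 0 1 "-1"]
      int[OF that, of s t 1 0 0] by simp_all
  note lc = E.C_infinity_on_lincomb[OF E.gauge_open_V]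
  note cong = E.C_infinity_on_cong[OF E.gauge_open_V order_refl]
  consider "\<alpha> = -1" | "\<alpha> = 1" | "\<alpha> \<noteq> 1" "\<alpha> \<noteq> -1" by blast
  then have "C_infinity_on ?V ?N ?V ?F"
  proof cases
    case 1
    show ?thesis
    proof (rule cong[OF lc[OF smooth smooth]])
      fix v assume "v \<in> ?V"
      then obtain a b where v: "v = (a, b)" "a \<in> Cb k B" "b \<in> Cb k B" by blast
      obtain P Q where "?F v = divergence k B \<mu> \<alpha> P Q" "?\<phi> P = a" "?\<phi> Q = b"
        using F v by metis
      then show "?F v = 1 * I 0 1 1 0 0 v + 1 * I 1 0 (-1) 1 (-1) v"
        using 1 divergence_m1_chart[of k B \<mu> P a Q b] int1[OF v(2,3)]
        by (simp add: divergence_def I_def v(1))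
    qed
  next
    case 2
    show ?thesis
    proof (rule cong[OF lc[OF smooth smooth]])
      fix v assume "v \<in> ?V"
      then obtain a b where v: "v = (a, b)" "a \<in> Cb k B" "b \<in> Cb k B" by blast
      obtain P Q where "?F v = divergence k B \<mu> \<alpha> P Q" "?\<phi> P = a" "?\<phi> Q = b"
        using F v by metis
      then show "?F v = 1 * I 1 0 1 0 0 v + 1 * I 0 1 (-1) (-1) 1 v"
        using 2 divergence_m1_chart[of k B \<mu> Q b P a] int1[OF v(3,2)]
        by (simp add: divergence_def I_def v(1))
    qed
  next
    case 3
    let ?\<beta> = "(1 - \<alpha>) / 2" and ?\<gamma> = "(1 + \<alpha>) / 2"
    show ?thesis
    proof (rule cong[OF lc[OF lc[OF smooth smooth] smooth]])
      fix v assume "v \<in> ?V"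
      then obtain a b where v: "v = (a, b)" "a \<in> Cb k B" "b \<in> Cb k B" by blast
      obtain P Q where PQ: "?F v = divergence k B \<mu> \<alpha> P Q" "?\<phi> P = a" "?\<phi> Q = b"
        using F v by metis
      show "?F v = 1 * (1 / ?\<gamma> * I 1 0 1 0 0 v + 1 / ?\<beta> * I 0 1 1 0 0 v)
          + - (1 / (?\<beta> * ?\<gamma>)) * I ?\<beta> ?\<gamma> 1 0 0 v"
        unfolding PQ(1) divergence_chart[OF assms(2) 3 PQ(2,3) int1(4)[OF v(2,3)]]
        by (simp add: I_def v(1))
    qed
  qed
  then show ?thesis unfolding C_infinity_manifold_def .
qed

end
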